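(* Let $h$ be a probability density on $\mathbb R$ such that: (i) $h$ is symmetric, positive, bounded, and decreasing on $[0,\infty)$; (ii) for some $c_1>0$, $\kappa\ge0$, $\log(1/h(x))\le c_1(1+\log^{1+\kappa}(1+x))$ for all $x\ge0$; (iii) for some $c_2>0$, $\int_x^\infty h(u)\,du\le c_2/x^2$ for all $x\ge1$. Let $\Pi$ be the prior on $f=\sum_{l\ge0}\sum_{k\in\mathcal K_l}f_{lk}\psi_{lk}$ under which $f_{lk}=s_l\zeta_{lk}$ with $(\zeta_{lk})$ i.i.d. of density $h$. (1) Suppose $s_l=2^{-l(1/2+\alpha)}$ with $\alpha>1/2$. For $\beta>0$ let $\varepsilon_n=(\log\log n)^{\frac{2}{1+2\beta}}(\log n)^{\frac{1+(1+\kappa)\beta}{1+2\beta}}n^{-\frac{\beta}{2\beta+1}}$. Then for any $0<\beta\le\alpha$, $L>0$ and $f_0\in\mathcal H^\beta(L)$, for any $d_2>0$ there exists $d_1>0$ sufficiently large such that, for large enough $n$, $$\Pi[\|f-f_0\|_\infty<d_1\varepsilon_n]\ge e^{-d_2n\varepsilon_n^2}.$$ (2) Suppose $s_l=2^{-l^2}$. For $\beta>0$ let $\varepsilon_n=(\log n)^{\frac{(2+2\kappa)\beta}{1+2\beta}}n^{-\frac{\beta}{2\beta+1}}$. Then for any $\beta>0$, $L>0$ and $f_0\in\mathcal H^\beta(L)$, for any $d_2>0$ there exists $d_1>0$ sufficiently large such that, for large enough $n$, $$\Pi[\|f-f_0\|_\infty<d_1\varepsilon_n]\ge e^{-d_2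n\varepsilon_n^2}.$$
   Context: $\{\psi_{lk}:l\ge0,k\in\mathcal K_l\}$, $\mathcal K_l=\{0,\dots,2^l-1\}$, is an orthonormal boundary-corrected wavelet basis of $L^2[0,1]$ (the scaling function being denoted as the first wavelet $\psi_{00}$); such a basis satisfies $\sup_{x\in[0,1]}\sum_{k\in\mathcal K_l}|\psi_{lk}(x)|\le C2^{l/2}$ for all $l$ and a constant $C$. Write $f_{lk}=\langle f,\psi_{lk}\rangle$. The Hölder-type ball is $\mathcal H^\beta(L)=\{f=(f_{lk}):\ \max_{k\in\mathcal K_l}|f_{lk}|\le2^{-l(1/2+\beta)}L\ \text{for all } l\ge0\}$. $\|\cdot\|_\infty$ is the supremum norm on $[0,1]$. *)

theory Defs
  imports "HOL-Probability.Probability"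
begin

definition wav_idx :: "nat \<Rightarrow> nat set" where
  "wav_idx l = {0..<2 ^ l}"

definition L2_unit :: "(real \<Rightarrow> real) \<Rightarrow> bool" where
  "L2_unit f \<longleftrightarrow> f \<in> borel_measurable (lebesgue_on {0..1}) \<and>
     integrable (lebesgue_on {0..1}) (\<lambda>x. (f x)\<^sup>2)"

definition L2_inner :: "(real \<Rightarrow> real) \<Rightarrow> (real \<Rightarrow> real) \<Rightarrow> real" where
  "L2_inner f g = (LINT x|lebesgue_on {0..1}. f x * g x)"

definition wav_coeff :: "(nat \<Rightarrow> nat \<Rightarrow> real \<Rightarrow> real) \<Rightarrow> (real \<Rightarrow> real) \<Rightarrow> nat \<Rightarrow> nat \<Rightarrow> real" where
  "wav_coeff \<psi> f l k = L2_inner f (\<psi> l k)"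

definition orthonormal_basis_L2 :: "(nat \<Rightarrow> nat \<Rightarrow> real \<Rightarrow> real) \<Rightarrow> bool" where
  "orthonormal_basis_L2 \<psi> \<longleftrightarrow>
     (\<forall>l. \<forall>k\<in>wav_idx l. L2_unit (\<psi> l k)) \<and>
     (\<forall>l. \<forall>k\<in>wav_idx l. \<forall>l'. \<forall>k'\<in>wav_idx l'.
        L2_inner (\<psi> l k) (\<psi> l' k') = (if l = l' \<and> k = k' then 1 else 0)) \<and>
     (\<forall>f. L2_unit f \<longrightarrow>
        (\<lambda>N. LINT x|lebesgue_on {0..1}.
           (f x - (\<Sum>l<N. \<Sum>k\<in>wav_idx l. wav_coeff \<psi> f l k * \<psi> l k x))\<^sup>2) \<longlonglongrightarrow> 0)"

text \<open>
  Of the particular construction of a boundary-corrected wavelet basis (with the scaling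
  function as \<open>\<psi> 0 0\<close>), only the orthonormal basis property and the localisation bound are
  recorded. Every such basis satisfies this predicate, so a statement about
  all families satisfying it covers every choice of the construction.
\<close>

definition localized_orthonormal_basis :: "(nat \<Rightarrow> nat \<Rightarrow> real \<Rightarrow> real) \<Rightarrow> bool" where
  "localized_orthonormal_basis \<psi> \<longleftrightarrow>
     orthonormal_basis_L2 \<psi> \<and>
     (\<exists>C. \<forall>l. \<forall>x\<in>{0..1}. (\<Sum>k\<in>wav_idx l. \<bar>\<psi> l k x\<bar>) \<le> C * 2 powr (real l / 2))"

text \<open>
  The supremum norm sees individual points, whereas wavelet coefficients only determine a
  function almost everywhere. The last conjunct selects the representative given
  by the wavelet series; for \<open>\<beta> > 0\<close> and a localized basis, that series converges uniformly,
  so each array of coefficients within the bounds has exactly one representative on \<open>[0,1]\<close>.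
\<close>

definition holder_ball ::
  "(nat \<Rightarrow> nat \<Rightarrow> real \<Rightarrow> real) \<Rightarrow> real \<Rightarrow> real \<Rightarrow> (real \<Rightarrow> real) set" where
  "holder_ball \<psi> \<beta> L = {f. L2_unit f \<and>
     (\<forall>l. (MAX k\<in>wav_idx l. \<bar>wav_coeff \<psi> f l k\<bar>) \<le> 2 powr (- real l * (1/2 + \<beta>)) * L) \<and>
     (\<forall>x\<in>{0..1}. (\<lambda>l. \<Sum>k\<in>wav_idx l. wav_coeff \<psi> f l k * \<psi> l k x) sums f x)}"

definition wav_indices :: "(nat \<times> nat) set" where
  "wav_indices = Sigma UNIV wav_idx"

text \<open>
  The prior is the law of the coefficient array \<open>(s l * \<zeta> (l, k))\<close>. It is completed because
  the set of arrays whose series converges pointwise but not uniformly need not be Borel;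
  supremum norm balls are then measurable as soon as uniform convergence holds almost surely.
\<close>

definition prior :: "(real \<Rightarrow> real) \<Rightarrow> (nat \<Rightarrow> real) \<Rightarrow> (nat \<times> nat \<Rightarrow> real) measure" where
  "prior h s = completion
     (distr (PiM wav_indices (\<lambda>_. density lborel (\<lambda>x. ennreal (h x))))
            (PiM wav_indices (\<lambda>_. borel))
            (\<lambda>\<zeta>. \<lambda>(l, k)\<in>wav_indices. s l * \<zeta> (l, k)))"

text \<open>Extended-valued, since the supremum of an unbounded set of reals is unspecified.\<close>

definition sup_norm_unit :: "(real \<Rightarrow> real) \<Rightarrow> ennreal" where
  "sup_norm_unit f = (SUP x\<in>{0..1}. ennreal \<bar>f x\<bar>)"

text \<open>The event \<open>\<parallel>f - f0\<parallel>\<^sub>\<infinity> < r\<close>, where \<open>f\<close> is the wavelet series with coefficients \<open>c\<close>.\<close>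

definition sup_ball ::
  "(nat \<Rightarrow> nat \<Rightarrow> real \<Rightarrow> real) \<Rightarrow> (real \<Rightarrow> real) \<Rightarrow> real \<Rightarrow> (nat \<times> nat \<Rightarrow> real) set" where
  "sup_ball \<psi> f0 r = {c \<in> wav_indices \<rightarrow>\<^sub>E UNIV.
     \<exists>f. (\<forall>x\<in>{0..1}. (\<lambda>l. \<Sum>k\<in>wav_idx l. c (l, k) * \<psi> l k x) sums f x) \<and>
         sup_norm_unit (\<lambda>x. f x - f0 x) < ennreal r}"

definition rate_regular :: "real \<Rightarrow> real \<Rightarrow> nat \<Rightarrow> real" where
  "rate_regular \<kappa> \<beta> n =
     ln (ln (real n)) powr (2 / (1 + 2 * \<beta>)) *
     ln (real n) powr ((1 + (1 + \<kappa>) * \<beta>) / (1 + 2 * \<beta>)) *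
     real n powr (- \<beta> / (2 * \<beta> + 1))"

definition rate_supersmooth :: "real \<Rightarrow> real \<Rightarrow> nat \<Rightarrow> real" where
  "rate_supersmooth \<kappa> \<beta> n =
     ln (real n) powr ((2 + 2 * \<kappa>) * \<beta> / (1 + 2 * \<beta>)) *
     real n powr (- \<beta> / (2 * \<beta> + 1))"

end

theory Submission
  imports Defs "HOL-Real_Asymp.Real_Asymp"
begin

text \<open>
  Both parts follow from one estimate at the rate \<open>(log\<^sup>q n / n)\<^bsup>\<beta>/(1+2\<beta>)\<^esup>\<close>, with
  \<open>q = 1 + \<kappa>\<close> for \<open>s l = 2\<^bsup>-l(1/2+\<alpha>)\<^esup>\<close> and \<open>q = 2 + 2\<kappa>\<close> for
  \<open>s l = 2\<^bsup>-l\<^sup>2\<^esup>\<close>; no larger power of a logarithm is needed in the regular case.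

  Fix a level \<open>J\<close>. Below \<open>J\<close>, require each coefficient to be within
  \<open>2\<^bsup>-J(1/2+\<beta>)\<^esup>\<close> of that of \<open>f0\<close>. By the lower bound on \<open>h\<close> each of these fewer than
  \<open>2\<^sup>J\<close> events costs a factor \<open>exp (- O (J\<^sup>q))\<close>, because \<open>log (1 / s l)\<close> is polynomial in
  \<open>l\<close>. From \<open>J\<close> on, require \<open>\<bar>\<zeta> (l, k)\<bar> \<le> T 2\<^bsup>(l-J)(1/2+\<eta>)\<^esup>\<close>. By the tail bound level
  \<open>l\<close> costs \<open>exp (- O (2\<^sup>J 2\<^bsup>-2\<eta>(l-J)\<^esup>))\<close>, so that all these levels together cost only
  \<open>exp (- O (2\<^sup>J))\<close>. On the resulting box, of probability at least
  \<open>exp (- B J\<^sup>q 2\<^sup>J)\<close>, the level contributions to the supremum norm decay geometrically on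
  both sides of \<open>J\<close> and add up to \<open>O (2\<^bsup>-J\<beta>\<^esup>)\<close>. Taking \<open>2\<^sup>J\<close> to be a small multiple of
  \<open>(n / log\<^sup>q n)\<^bsup>1/(1+2\<beta>)\<^esup>\<close> gives the theorem, the smallness being paid for by \<open>d1\<close>.

  A supremum norm ball has positive measure only if it is measurable. The \<open>\<psi> l k\<close> need not be
  continuous, but \<open>[0,1]\<close> has a countable subset whose image under
  \<open>x \<mapsto> (\<psi> l k x)\<close> is dense in the image of \<open>[0,1]\<close> for the product topology, and a uniformly
  convergent series in the \<open>\<psi> l k\<close> has the same supremum over both sets. Almost all coefficient
  arrays give uniformly convergent series by the Borel--Cantelli lemma.
\<close>

subsection \<open>Boxes and small balls under the noise\<close>

text \<open>The infinite box is the decreasing intersection of the cylinders over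
  \<open>F n\<close>, whose probabilities are finite products. Continuity from above carries a bound
  uniform in \<open>n\<close> over to the box.\<close>

lemma (in product_prob_space) measure_PiM_PiE_ge:
  assumes F: "incseq F" "(\<Union>n. F n) = I" "\<And>n. finite (F n)"
    and A: "\<And>i. i \<in> I \<Longrightarrow> A i \<in> sets (M i)"
    and p: "\<And>n. p \<le> (\<Prod>i\<in>F n. measure (M i) (A i))"
  shows "Pi\<^sub>E I A \<in> sets (PiM I M)" and "p \<le> measure (PiM I M) (Pi\<^sub>E I A)"
proof -
  let ?B = "\<lambda>n. emb I (F n) (Pi\<^sub>E (F n) A)"
  have sub: "F n \<subseteq> I" for n
    using F(2) by auto
  have B: "?B n = {x \<in> space (PiM I M). \<forall>i\<in>F n. x i \<in> A i}" for n
    using sub[of n] A sets.sets_into_space unfolding prod_emb_def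
    by (auto simp: space_PiM Pi_iff)
  have sets_B: "?B n \<in> sets (PiM I M)" for n
    using A sub[of n] F(3)[of n] by (intro measurable_prod_emb sets_PiM_I_finite) auto
  have "decseq ?B"
    unfolding B decseq_def using F(1) by (auto simp: incseq_def)
  have eq: "(\<Inter>n. ?B n) = Pi\<^sub>E I A"
    unfolding B using F(2) A[THEN sets.sets_into_space]
    by (auto simp: space_PiM PiE_def Pi_iff extensional_def subset_eq)
  show "Pi\<^sub>E I A \<in> sets (PiM I M)"
    unfolding eq[symmetric] using sets_B by (intro sets.countable_INT) auto
  have lim: "(\<lambda>n. measure (PiM I M) (?B n)) \<longlonglongrightarrow> measure (PiM I M) (Pi\<^sub>E I A)"
    unfolding eq[symmetric] using sets_B \<open>decseq ?B\<close>
    by (intro P.finite_Lim_measure_decseq) auto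
  show "p \<le> measure (PiM I M) (Pi\<^sub>E I A)"
  proof (rule LIMSEQ_le_const[OF lim])
    have "p \<le> measure (PiM I M) (?B n)" for n
      using p[of n] measure_PiM_emb[of "F n" A] sub[of n] F(3) A by (auto simp: subset_eq)
    then show "\<exists>N. \<forall>n\<ge>N. p \<le> measure (PiM I M) (?B n)"
      by blast
  qed
qed

section \<open>Interval and tail probabilities of the noise\<close>

locale noise_density =
  fixes h :: "real \<Rightarrow> real" and \<kappa> c1 c2 :: real
  assumes h_measurable [measurable]: "h \<in> borel_measurable borel"
    and h_density: "prob_space (density lborel (\<lambda>x. ennreal (h x)))"
    and h_symmetric: "\<And>x. h (- x) = h x"
    and h_positive: "\<And>x. 0 < h x"
    and h_decreasing: "antimono_on {0..} h"
    and const_ranges: "0 < c1" "0 \<le> \<kappa>" "0 < c2"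
    and h_lower: "\<And>x. 0 \<le> x \<Longrightarrow> ln (1 / h x) \<le> c1 * (1 + ln (1 + x) powr (1 + \<kappa>))"
    and h_tail: "\<And>x. 1 \<le> x \<Longrightarrow> (LINT u:{x..}|lborel. h u) \<le> c2 / x\<^sup>2"
begin

definition noise :: "real measure" where
  "noise = density lborel (\<lambda>x. ennreal (h x))"

lemma sets_noise [simp, measurable_cong]: "sets noise = sets borel"
  by (simp add: noise_def)

lemma space_noise [simp]: "space noise = UNIV"
  by (simp add: noise_def)

lemma prob_space_noise: "prob_space noise"
  unfolding noise_def by (rule h_density)

lemma integrable_h: "integrable lborel h"
proof (rule integrableI_nonneg)
  interpret prob_space noise by (rule prob_space_noise)
  have "(\<integral>\<^sup>+ x. ennreal (h x) \<partial>lborel) = emeasure noise (space noise)"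
    by (simp add: noise_def emeasure_density)
  then show "(\<integral>\<^sup>+ x. ennreal (h x) \<partial>lborel) < \<infinity>"
    using emeasure_space_1 by simp
qed (use h_positive in \<open>auto intro: less_imp_le\<close>)

lemma integrable_h_indicator:
  assumes "A \<in> sets borel"
  shows "integrable lborel (\<lambda>x. h x * indicator A x)"
  using integrable_mult_indicator[of A lborel h] integrable_h assms
  by (simp add: mult.commute)

lemma measure_noise:
  assumes [measurable]: "A \<in> sets borel"
  shows "measure noise A = (LINT x|lborel. h x * indicator A x)"
proof -
  have "emeasure noise A = (\<integral>\<^sup>+ x. ennreal (h x * indicator A x) \<partial>lborel)"
    unfolding noise_def by (subst emeasure_density) (auto simp: nn_integral_set_ennreal)
  also have "\<dots> = ennreal (LINT x|lborel. h x * indicator A x)"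
    using integrable_h_indicator[OF assms] h_positive
    by (intro nn_integral_eq_integral) (auto intro!: AE_I2 mult_nonneg_nonneg intro: less_imp_le)
  finally show ?thesis
    using h_positive[THEN less_imp_le]
    by (auto simp: measure_def intro!: enn2real_ennreal integral_nonneg_AE AE_I2)
qed

lemma measure_noise_tail:
  assumes "1 \<le> t"
  shows "measure noise {x. t < \<bar>x\<bar>} \<le> 2 * c2 / t\<^sup>2"
proof -
  interpret prob_space noise by (rule prob_space_noise)
  have right: "measure noise {t..} \<le> c2 / t\<^sup>2"
    using h_tail[OF assms] by (simp add: measure_noise set_lebesgue_integral_def mult.commute)
  have "measure noise {..-t} = (LINT x|lborel. h (- x) * indicator {..-t} (- x))"
    using lborel_integral_real_affine[of "-1" "\<lambda>x. h x * indicator {..-t} x" 0]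
    by (simp add: measure_noise)
  also have "\<dots> = measure noise {t..}"
    by (auto simp: measure_noise h_symmetric indicator_def intro!: Bochner_Integration.integral_cong)
  finally have left: "measure noise {..-t} \<le> c2 / t\<^sup>2"
    using right by simp
  have "measure noise {x. t < \<bar>x\<bar>} \<le> measure noise ({t..} \<union> {..-t})"
    by (intro finite_measure_mono) auto
  also have "\<dots> \<le> measure noise {t..} + measure noise {..-t}"
    by (intro measure_Un_le) auto
  finally show ?thesis
    using left right by simp
qed

text \<open>Every point of the interval has modulus at most \<open>\<bar>a\<bar> + r\<close>, so by
  symmetry and monotonicity the density there is at least its value at
  \<open>\<bar>a\<bar> + r\<close>, which \<open>h_lower\<close> bounds below by an
  exponential.\<close>

lemma measure_noise_cball_ge:
  assumes "0 \<le> r"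
  shows "2 * r * exp (- (c1 * (1 + ln (1 + (\<bar>a\<bar> + r)) powr (1 + \<kappa>)))) \<le> measure noise {x. \<bar>x - a\<bar> \<le> r}"
proof -
  have set_eq: "{x. \<bar>x - a\<bar> \<le> r} = {a - r..a + r}"
    by auto
  have le: "h (\<bar>a\<bar> + r) \<le> h x" if "x \<in> {a - r..a + r}" for x
  proof -
    have "h (\<bar>a\<bar> + r) \<le> h \<bar>x\<bar>"
      using that assms by (intro monotone_onD[OF h_decreasing]) auto
    then show ?thesis
      using h_symmetric[of x] by (simp add: abs_if split: if_splits)
  qed
  have "h (\<bar>a\<bar> + r) * (2 * r) = (LINT x|lborel. h (\<bar>a\<bar> + r) * indicator {a - r..a + r} x)"
    using assms by simp
  also have "\<dots> \<le> (LINT x|lborel. h x * indicator {a - r..a + r} x)"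
    using le assms by (intro integral_mono integrable_h_indicator integrable_mult_right integrable_real_indicator)
      (auto split: split_indicator)
  also have "\<dots> = measure noise {x. \<bar>x - a\<bar> \<le> r}"
    unfolding set_eq by (simp add: measure_noise)
  finally have *: "h (\<bar>a\<bar> + r) * (2 * r) \<le> measure noise {x. \<bar>x - a\<bar> \<le> r}" .
  have "- ln (h (\<bar>a\<bar> + r)) \<le> c1 * (1 + ln (1 + (\<bar>a\<bar> + r)) powr (1 + \<kappa>))"
    using h_lower[of "\<bar>a\<bar> + r"] h_positive[of "\<bar>a\<bar> + r"] assms by (simp add: ln_div)
  then have "exp (- (c1 * (1 + ln (1 + (\<bar>a\<bar> + r)) powr (1 + \<kappa>)))) \<le> exp (ln (h (\<bar>a\<bar> + r)))"
    by simp
  also have "\<dots> = h (\<bar>a\<bar> + r)"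
    using h_positive by simp
  finally show ?thesis
    using * assms by (intro order.trans[OF _ *]) (simp add: mult_left_mono mult.commute)
qed

end

subsection \<open>Supremum norm of series in a localized family\<close>

text \<open>A measurable set of arrays whose series converges uniformly when \<eta> > 0. The bound
  is asked for only from some level \<open>N\<close> on, which is what Borel-Cantelli can
  deliver.\<close>

definition regular_coeffs :: "real \<Rightarrow> real \<Rightarrow> (nat \<times> nat \<Rightarrow> real) set" where
  "regular_coeffs K \<eta> = {c \<in> wav_indices \<rightarrow>\<^sub>E UNIV.
     \<exists>N. \<forall>l\<ge>N. \<forall>k\<in>wav_idx l. \<bar>c (l, k)\<bar> \<le> K * 2 powr (- real l * (1/2 + \<eta>))}"

lemma wav_indices_iff [simp]: "(l, k) \<in> wav_indices \<longleftrightarrow> k \<in> wav_idx l"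
  by (simp add: wav_indices_def)

lemma finite_wav_idx [simp]: "finite (wav_idx l)"
  by (simp add: wav_idx_def)

lemma card_wav_idx [simp]: "card (wav_idx l) = 2 ^ l"
  by (simp add: wav_idx_def)

lemma wav_idx_nonempty: "0 \<in> wav_idx l"
  by (simp add: wav_idx_def)

lemma sets_regular_coeffs [measurable]:
  "regular_coeffs K \<eta> \<in> sets (PiM wav_indices (\<lambda>_. borel))"
proof -
  have "(\<lambda>c. c (l, k)) \<in> borel_measurable (PiM wav_indices (\<lambda>_. borel :: real measure))"
    if "k \<in> wav_idx l" for l k
    using that by (intro measurable_component_singleton) simp
  note [measurable] = this
  have "regular_coeffs K \<eta> = {c \<in> space (PiM wav_indices (\<lambda>_. borel)).
     \<exists>N. \<forall>l\<in>{N..}. \<forall>k\<in>wav_idx l. \<bar>c (l, k)\<bar> \<le> K * 2 powr (- real l * (1/2 + \<eta>))}"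
    by (auto simp: regular_coeffs_def space_PiM)
  also have "\<dots> \<in> sets (PiM wav_indices (\<lambda>_. borel))"
    by measurable
  finally show ?thesis .
qed

locale localized_family =
  fixes \<psi> :: "nat \<Rightarrow> nat \<Rightarrow> real \<Rightarrow> real" and C :: real
  assumes C_pos: "0 < C"
    and localized: "\<And>l x. x \<in> {0..1} \<Longrightarrow> (\<Sum>k\<in>wav_idx l. \<bar>\<psi> l k x\<bar>) \<le> C * 2 powr (real l / 2)"
begin

lemma level_bound:
  assumes a: "\<And>k. k \<in> wav_idx l \<Longrightarrow> \<bar>a k\<bar> \<le> m" and x: "x \<in> {0..1}"
  shows "\<bar>\<Sum>k\<in>wav_idx l. a k * \<psi> l k x\<bar> \<le> C * (m * 2 powr (real l / 2))"
proof -
  have m: "0 \<le> m"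
    using a[OF wav_idx_nonempty] by linarith
  have "\<bar>\<Sum>k\<in>wav_idx l. a k * \<psi> l k x\<bar> \<le> (\<Sum>k\<in>wav_idx l. \<bar>a k * \<psi> l k x\<bar>)"
    by (rule sum_abs)
  also have "\<dots> \<le> (\<Sum>k\<in>wav_idx l. m * \<bar>\<psi> l k x\<bar>)"
    using a by (intro sum_mono) (simp add: abs_mult mult_right_mono)
  also have "\<dots> = m * (\<Sum>k\<in>wav_idx l. \<bar>\<psi> l k x\<bar>)"
    by (simp add: sum_distrib_left)
  also have "\<dots> \<le> m * (C * 2 powr (real l / 2))"
    using localized[OF x] m by (intro mult_left_mono)
  finally show ?thesis
    by (simp add: mult_ac)
qed

lemma regular_level_bound:
  assumes "\<And>k. k \<in> wav_idx l \<Longrightarrow> \<bar>a k\<bar> \<le> K * 2 powr (- real l * (1/2 + \<eta>))" and "x \<in> {0..1}"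
  shows "norm (\<Sum>k\<in>wav_idx l. a k * \<psi> l k x) \<le> C * K * (2 powr - \<eta>) ^ l"
proof -
  have "2 powr (- real l * (1/2 + \<eta>)) * 2 powr (real l / 2) = 2 powr (- \<eta> * real l)"
    by (simp add: powr_add[symmetric] algebra_simps)
  also have "\<dots> = (2 powr - \<eta>) ^ l"
    using powr_powr[of 2 "- \<eta>" "real l"] by (simp add: powr_realpow)
  finally have "C * (K * 2 powr (- real l * (1/2 + \<eta>)) * 2 powr (real l / 2)) = C * K * (2 powr - \<eta>) ^ l"
    by (simp only: mult.assoc)
  then show ?thesis
    using level_bound[of l a, OF assms] unfolding real_norm_def by (simp only:)
qed

lemma summable_regular:
  assumes "0 < \<eta>"
    and "\<forall>l\<ge>N. \<forall>k\<in>wav_idx l. \<bar>a l k\<bar> \<le> K * 2 powr (- real l * (1/2 + \<eta>))" and "x \<in> {0..1}"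
  shows "summable (\<lambda>l. \<Sum>k\<in>wav_idx l. a l k * \<psi> l k x)"
proof (rule summable_comparison_test)
  show "\<exists>N. \<forall>l\<ge>N. norm (\<Sum>k\<in>wav_idx l. a l k * \<psi> l k x) \<le> C * K * (2 powr - \<eta>) ^ l"
    using regular_level_bound assms(2,3) by blast
  show "summable (\<lambda>l. C * K * (2 powr - \<eta>) ^ l)"
    using assms(1) by (intro summable_mult summable_geometric) (simp add: powr_less_one)
qed

text \<open>As the \<open>\<psi> l k\<close> may be discontinuous, rational points would not do. The
  space of functions on the countable set \<open>nat \<times> nat\<close> is second countable and
  metrizable, so the image of [0,1] in it is separable, and a countable dense part of the image is
  pulled back to points.\<close>

lemma countable_dense_points:
  obtains D where "countable D" "D \<subseteq> {0..1}"
    "\<And>x. x \<in> {0..1} \<Longrightarrow> \<exists>d. (\<forall>n. d n \<in> D) \<and> (\<forall>l k. (\<lambda>n::nat. \<psi> l k (d n)) \<longlonglongrightarrow> \<psi> l k x)"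
proof -
  define \<Phi> :: "real \<Rightarrow> nat \<times> nat \<Rightarrow> real" where "\<Phi> x = (\<lambda>(l, k). \<psi> l k x)" for x
  obtain T where T: "countable T" "T \<subseteq> \<Phi> ` {0..1}" "\<Phi> ` {0..1} \<subseteq> closure T"
    using separable[of "\<Phi> ` {0..1}"] by blast
  then obtain D where D: "countable D" "D \<subseteq> {0..1}" "T = \<Phi> ` D"
    using countable_subset_image[of T \<Phi> "{0..1}"] by blast
  have dense: "\<exists>d. (\<forall>n. d n \<in> D) \<and> (\<forall>l k. (\<lambda>n::nat. \<psi> l k (d n)) \<longlonglongrightarrow> \<psi> l k x)"
    if "x \<in> {0..1}" for x
  proof -
    have "\<Phi> x \<in> closure T"
      using T(3) that by blast
    then obtain y where y: "\<And>n. y n \<in> T" "y \<longlonglongrightarrow> \<Phi> x"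
      unfolding closure_sequential by blast
    have "\<forall>n. \<exists>z. z \<in> D \<and> y n = \<Phi> z"
      using y(1) D(3) by blast
    then obtain d where d: "\<And>n. d n \<in> D" "\<And>n. y n = \<Phi> (d n)"
      by metis
    have "(\<lambda>n. \<psi> l k (d n)) \<longlonglongrightarrow> \<psi> l k x" for l k
    proof -
      have "(\<lambda>n. y n (l, k)) \<longlonglongrightarrow> \<Phi> x (l, k)"
        using continuous_on_tendsto_compose[OF continuous_on_product_coordinates[of "(l, k)"] y(2)]
        by simp
      then show ?thesis
        by (simp add: d(2) \<Phi>_def)
    qed
    then show ?thesis
      using d(1) by blast
  qed
  show ?thesis
    by (rule that[OF D(1,2) dense])
qed

text \<open>Along points \<open>d n\<close> at which every \<open>\<psi> l k\<close> tends to its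
  value at \<open>x\<close>, Tannery's theorem takes the limit inside the series: the geometric
  majorant does not depend on \<open>n\<close> and is needed for large \<open>l\<close>
  only.\<close>

lemma SUP_eq_dense:
  assumes D: "D \<subseteq> {0..1}"
    "\<And>x. x \<in> {0..1} \<Longrightarrow> \<exists>d. (\<forall>n. d n \<in> D) \<and> (\<forall>l k. (\<lambda>n::nat. \<psi> l k (d n)) \<longlonglongrightarrow> \<psi> l k x)"
    and "0 < \<eta>"
    and a: "\<forall>l\<ge>N. \<forall>k\<in>wav_idx l. \<bar>a l k\<bar> \<le> K * 2 powr (- real l * (1/2 + \<eta>))"
  defines "g \<equiv> \<lambda>x. \<Sum>l. \<Sum>k\<in>wav_idx l. a l k * \<psi> l k x"
  shows "(SUP x\<in>{0..1}. ennreal \<bar>g x\<bar>) = (SUP x\<in>D. ennreal \<bar>g x\<bar>)"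
proof (rule antisym)
  show "(SUP x\<in>D. ennreal \<bar>g x\<bar>) \<le> (SUP x\<in>{0..1}. ennreal \<bar>g x\<bar>)"
    using D(1) by (rule SUP_subset_mono) simp
  show "(SUP x\<in>{0..1}. ennreal \<bar>g x\<bar>) \<le> (SUP x\<in>D. ennreal \<bar>g x\<bar>)"
  proof (rule SUP_least)
    fix x :: real assume "x \<in> {0..1}"
    from D(2)[OF this] obtain d where d: "\<And>n. d n \<in> D"
      "\<And>l k. (\<lambda>n::nat. \<psi> l k (d n)) \<longlonglongrightarrow> \<psi> l k x"
      by blast
    have "(\<lambda>n. \<Sum>k\<in>wav_idx l. a l k * \<psi> l k (d n)) \<longlonglongrightarrow> (\<Sum>k\<in>wav_idx l. a l k * \<psi> l k x)" for l
      by (intro tendsto_intros d)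
    moreover have "\<forall>\<^sub>F (l, n) in at_top \<times>\<^sub>F sequentially.
        norm (\<Sum>k\<in>wav_idx l. a l k * \<psi> l k (d n)) \<le> C * K * (2 powr - \<eta>) ^ l"
      unfolding eventually_prod_filter
      using regular_level_bound a d(1) D(1)
      by (intro exI[of _ "\<lambda>l. N \<le> l"] exI[of _ "\<lambda>_. True"]) (auto simp: eventually_ge_at_top subset_eq)
    moreover have "summable (\<lambda>l. C * K * (2 powr - \<eta>) ^ l)"
      using \<open>0 < \<eta>\<close> by (intro summable_mult summable_geometric) (simp add: powr_less_one)
    ultimately have "(\<lambda>n. g (d n)) \<longlonglongrightarrow> g x"
      unfolding g_def by (intro conjunct2[OF conjunct2[OF tannerys_theorem]]) auto
    then have "(\<lambda>n. ennreal \<bar>g (d n)\<bar>) \<longlonglongrightarrow> ennreal \<bar>g x\<bar>"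
      by (intro tendsto_intros)
    then show "ennreal \<bar>g x\<bar> \<le> (SUP x\<in>D. ennreal \<bar>g x\<bar>)"
    proof (rule LIMSEQ_le_const2)
      have "ennreal \<bar>g (d n)\<bar> \<le> (SUP x\<in>D. ennreal \<bar>g x\<bar>)" for n
        by (rule SUP_upper[OF d(1)])
      then show "\<exists>N. \<forall>n\<ge>N. ennreal \<bar>g (d n)\<bar> \<le> (SUP x\<in>D. ennreal \<bar>g x\<bar>)"
        by blast
    qed
  qed
qed

end

section \<open>Measurability of supremum norm balls around the target\<close>

locale wavelet_target = localized_family +
  fixes f0 :: "real \<Rightarrow> real" and b :: "nat \<Rightarrow> nat \<Rightarrow> real" and \<beta> L :: real
  assumes \<beta>_pos: "0 < \<beta>" and L_pos: "0 < L"
    and b_bound: "\<And>l k. k \<in> wav_idx l \<Longrightarrow> \<bar>b l k\<bar> \<le> L * 2 powr (- real l * (1/2 + \<beta>))"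
    and f0_sums: "\<And>x. x \<in> {0..1} \<Longrightarrow> (\<lambda>l. \<Sum>k\<in>wav_idx l. b l k * \<psi> l k x) sums f0 x"
begin

text \<open>For regular coefficients the series converges everywhere on [0,1], so the limit function
  quantified in \<open>sup_ball\<close> is determined there. Subtracting the series of
  \<open>f0\<close> leaves a single series.\<close>

lemma mem_sup_ball_iff:
  assumes c: "c \<in> regular_coeffs K \<eta>" and "0 < \<eta>"
  shows "c \<in> sup_ball \<psi> f0 r \<longleftrightarrow>
    (SUP x\<in>{0..1}. ennreal \<bar>\<Sum>l. \<Sum>k\<in>wav_idx l. (c (l, k) - b l k) * \<psi> l k x\<bar>) < ennreal r"
    (is "_ \<longleftrightarrow> ?S < _")
proof -
  obtain N where N: "\<forall>l\<ge>N. \<forall>k\<in>wav_idx l. \<bar>c (l, k)\<bar> \<le> K * 2 powr (- real l * (1/2 + \<eta>))"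
    using c by (auto simp: regular_coeffs_def)
  define g where "g x = (\<Sum>l. \<Sum>k\<in>wav_idx l. c (l, k) * \<psi> l k x)" for x
  have g: "(\<lambda>l. \<Sum>k\<in>wav_idx l. c (l, k) * \<psi> l k x) sums g x" if "x \<in> {0..1}" for x
    unfolding g_def using summable_regular[OF \<open>0 < \<eta>\<close> N that] by (rule summable_sums)
  have diff: "(\<Sum>l. \<Sum>k\<in>wav_idx l. (c (l, k) - b l k) * \<psi> l k x) = g x - f0 x" if "x \<in> {0..1}" for x
    using sums_diff[OF g f0_sums, OF that that]
    by (auto simp: left_diff_distrib sum_subtractf sums_iff)
  then have S: "?S = sup_norm_unit (\<lambda>x. g x - f0 x)"
    unfolding sup_norm_unit_def by (intro SUP_cong) auto
  have norm_eq: "sup_norm_unit (\<lambda>x. f x - f0 x) = sup_norm_unit (\<lambda>x. g x - f0 x)"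
    if "\<forall>x\<in>{0..1}. (\<lambda>l. \<Sum>k\<in>wav_idx l. c (l, k) * \<psi> l k x) sums f x" for f
  proof -
    have "f x = g x" if "x \<in> {0..1}" for x
      using g[OF that] \<open>\<forall>x\<in>{0..1}. _\<close> that sums_unique2 by blast
    then show ?thesis
      unfolding sup_norm_unit_def by (intro SUP_cong) auto
  qed
  have "c \<in> wav_indices \<rightarrow>\<^sub>E UNIV"
    using c by (simp add: regular_coeffs_def)
  then have "c \<in> sup_ball \<psi> f0 r \<longleftrightarrow>
      (\<exists>f. (\<forall>x\<in>{0..1}. (\<lambda>l. \<Sum>k\<in>wav_idx l. c (l, k) * \<psi> l k x) sums f x) \<and>
        sup_norm_unit (\<lambda>x. f x - f0 x) < ennreal r)"
    by (simp add: sup_ball_def)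
  also have "\<dots> \<longleftrightarrow> sup_norm_unit (\<lambda>x. g x - f0 x) < ennreal r"
  proof
    assume "\<exists>f. (\<forall>x\<in>{0..1}. (\<lambda>l. \<Sum>k\<in>wav_idx l. c (l, k) * \<psi> l k x) sums f x) \<and>
        sup_norm_unit (\<lambda>x. f x - f0 x) < ennreal r"
    then obtain f where f: "\<forall>x\<in>{0..1}. (\<lambda>l. \<Sum>k\<in>wav_idx l. c (l, k) * \<psi> l k x) sums f x"
      "sup_norm_unit (\<lambda>x. f x - f0 x) < ennreal r"
      by (elim exE conjE)
    show "sup_norm_unit (\<lambda>x. g x - f0 x) < ennreal r"
      using f(2) norm_eq[OF f(1)] by simp
  next
    assume "sup_norm_unit (\<lambda>x. g x - f0 x) < ennreal r"
    then show "\<exists>f. (\<forall>x\<in>{0..1}. (\<lambda>l. \<Sum>k\<in>wav_idx l. c (l, k) * \<psi> l k x) sums f x) \<and>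
        sup_norm_unit (\<lambda>x. f x - f0 x) < ennreal r"
      using g by (intro exI[of _ g] conjI ballI)
  qed
  finally show ?thesis
    unfolding S .
qed

text \<open>Inside the regular coefficients the supremum may be taken over a countable
  \<open>D\<close>, which makes it a measurable function of the coefficients.\<close>

lemma sup_ball_Int_regular_measurable:
  assumes "0 < \<eta>" "0 \<le> K"
  shows "sup_ball \<psi> f0 r \<inter> regular_coeffs K \<eta> \<in> sets (PiM wav_indices (\<lambda>_. borel))"
proof -
  let ?Q = "PiM wav_indices (\<lambda>_. borel :: real measure)"
  let ?g = "\<lambda>c x. \<Sum>l. \<Sum>k\<in>wav_idx l. (c (l, k) - b l k) * \<psi> l k x"
  obtain D where D: "countable D" "D \<subseteq> {0..1}"
    "\<And>x. x \<in> {0..1} \<Longrightarrow> \<exists>d. (\<forall>n. d n \<in> D) \<and> (\<forall>l k. (\<lambda>n::nat. \<psi> l k (d n)) \<longlonglongrightarrow> \<psi> l k x)"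
    using countable_dense_points by blast
  have SUP_D: "(SUP x\<in>{0..1}. ennreal \<bar>?g c x\<bar>) = (SUP x\<in>D. ennreal \<bar>?g c x\<bar>)"
    if c: "c \<in> regular_coeffs K \<eta>" for c
  proof -
    obtain N where N: "\<forall>l\<ge>N. \<forall>k\<in>wav_idx l. \<bar>c (l, k)\<bar> \<le> K * 2 powr (- real l * (1/2 + \<eta>))"
      using c by (auto simp: regular_coeffs_def)
    \<comment> \<open>The differences of coefficients decay at the slower of the two rates, that of
      the array and that of the target.\<close>
    let ?m = "min \<eta> \<beta>"
    have "\<bar>c (l, k) - b l k\<bar> \<le> (K + L) * 2 powr (- real l * (1/2 + ?m))"
      if "l \<ge> N" "k \<in> wav_idx l" for l k
    proof -
      have "\<bar>c (l, k)\<bar> \<le> K * 2 powr (- real l * (1/2 + \<eta>))"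
        using N that by blast
      also have "\<dots> \<le> K * 2 powr (- real l * (1/2 + ?m))"
        using \<open>0 \<le> K\<close> by (intro mult_left_mono powr_mono mult_left_mono_neg) auto
      finally have 1: "\<bar>c (l, k)\<bar> \<le> K * 2 powr (- real l * (1/2 + ?m))" .
      have "\<bar>b l k\<bar> \<le> L * 2 powr (- real l * (1/2 + \<beta>))"
        using b_bound that by blast
      also have "\<dots> \<le> L * 2 powr (- real l * (1/2 + ?m))"
        using L_pos by (intro mult_left_mono powr_mono mult_left_mono_neg) auto
      finally show ?thesis
        using 1 by (simp add: distrib_right)
    qed
    then show ?thesis
      using \<open>0 < \<eta>\<close> \<beta>_pos by (intro SUP_eq_dense[OF D(2,3), where \<eta> = ?m and N = N and K = "K + L"]) auto
  qed
  have "(\<lambda>c. c (l, k)) \<in> borel_measurable ?Q" if "k \<in> wav_idx l" for l k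
    using that by (intro measurable_component_singleton) simp
  then have "(\<lambda>c. ?g c x) \<in> borel_measurable ?Q" for x
    by (intro borel_measurable_suminf borel_measurable_sum borel_measurable_times borel_measurable_diff) auto
  then have meas: "(\<lambda>c. SUP x\<in>D. ennreal \<bar>?g c x\<bar>) \<in> borel_measurable ?Q"
    using D(1) by (intro borel_measurable_SUP) measurable
  have "c \<in> sup_ball \<psi> f0 r \<longleftrightarrow> (SUP x\<in>D. ennreal \<bar>?g c x\<bar>) < ennreal r"
    if "c \<in> regular_coeffs K \<eta>" for c
    using mem_sup_ball_iff[OF that \<open>0 < \<eta>\<close>] SUP_D[OF that] by simp
  moreover have "regular_coeffs K \<eta> \<subseteq> space ?Q"
    using sets.sets_into_space[OF sets_regular_coeffs] .
  ultimately have "sup_ball \<psi> f0 r \<inter> regular_coeffs K \<eta> =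
      regular_coeffs K \<eta> \<inter> {c \<in> space ?Q. (SUP x\<in>D. ennreal \<bar>?g c x\<bar>) < ennreal r}"
    by blast
  also have "\<dots> \<in> sets ?Q"
    using borel_measurable_less[OF meas borel_measurable_const] by (intro sets.Int sets_regular_coeffs)
  finally show ?thesis .
qed

end

subsection \<open>The law of the coefficient array\<close>

lemma sum_power_inj_le:
  fixes q :: real
  assumes "0 < q" "q < 1" "finite S" "inj_on g S"
  shows "(\<Sum>l\<in>S. q ^ g l) \<le> 1 / (1 - q)"
proof -
  have "(\<Sum>l\<in>S. q ^ g l) = (\<Sum>i\<in>g ` S. q ^ i)"
    using assms(4) by (simp add: sum.reindex)
  also have "\<dots> \<le> (\<Sum>i. q ^ i)"
    using assms by (intro sum_le_suminf) (auto intro: summable_geometric)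
  finally show ?thesis
    using assms by (simp add: suminf_geometric)
qed

text \<open>The exponents on each side of \<open>J\<close> are distinct, so each side is at most a
  full geometric series. The estimate serves twice: for the cost of the box in probability and for
  the supremum norm summed over levels.\<close>

lemma sum_two_sided_geometric_le:
  fixes q G :: real
  assumes q: "0 < q" "q < 1" and "0 \<le> G"
    and low: "\<And>l. l < J \<Longrightarrow> a l \<le> G * q ^ (J - l)"
    and high: "\<And>l. J \<le> l \<Longrightarrow> a l \<le> G * q ^ (l - J)"
  shows "(\<Sum>l<N. a l) \<le> G * (2 / (1 - q))"
proof -
  have "(\<Sum>l<N. a l) = (\<Sum>l\<in>{..<N} \<inter> {..<J}. a l) + (\<Sum>l\<in>{..<N} - {..<J}. a l)"
    by (subst sum.Int_Diff[where B = "{..<J}"]) auto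
  also have "\<dots> \<le> (\<Sum>l\<in>{..<N} \<inter> {..<J}. G * q ^ (J - l)) + (\<Sum>l\<in>{..<N} - {..<J}. G * q ^ (l - J))"
    using low high by (intro add_mono sum_mono) auto
  also have "\<dots> = G * ((\<Sum>l\<in>{..<N} \<inter> {..<J}. q ^ (J - l)) + (\<Sum>l\<in>{..<N} - {..<J}. q ^ (l - J)))"
    by (simp add: sum_distrib_left distrib_left)
  also have "\<dots> \<le> G * (1 / (1 - q) + 1 / (1 - q))"
    using q \<open>0 \<le> G\<close> by (intro mult_left_mono add_mono sum_power_inj_le) (auto simp: inj_on_def)
  finally show ?thesis
    by simp
qed

lemma abs_suminf_le:
  fixes a :: "nat \<Rightarrow> real"
  assumes "\<And>n. (\<Sum>i<n. \<bar>a i\<bar>) \<le> B"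
  shows "\<bar>suminf a\<bar> \<le> B"
proof -
  have "summable (\<lambda>i. \<bar>a i\<bar>)"
    using assms by (intro summableI_nonneg_bounded) auto
  then show ?thesis
    using summable_rabs[of a] suminf_le_const[of "\<lambda>i. \<bar>a i\<bar>" B] assms by simp
qed

text \<open>
  The regular scales have \<open>\<eta> = (\<alpha> - 1/2) / 2\<close> and \<open>p = 1\<close>; the supersmooth ones have
  \<open>p = 2\<close> and admit every \<open>\<eta>\<close>, with \<open>K\<close> depending on it.
\<close>

locale prior_setup = noise_density h \<kappa> c1 c2 + wavelet_target \<psi> C f0 b \<beta> L
  for h \<kappa> c1 c2 \<psi> C f0 b \<beta> L +
  fixes s :: "nat \<Rightarrow> real" and K \<eta> p A :: real
  assumes s_pos: "\<And>l. 0 < s l" and s_le_1: "\<And>l. s l \<le> 1"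
    and s_upper: "\<And>l. s l \<le> K * 2 powr (- real l * (1 + 2 * \<eta>))"
    and s_lower: "\<And>l. - ln (s l) \<le> A * (1 + real l) powr p"
    and \<eta>_pos: "0 < \<eta>" and \<beta>_le: "\<beta> \<le> 1/2 + 2 * \<eta>" and p_ge_1: "1 \<le> p" and A_nonneg: "0 \<le> A"
begin

abbreviation noise_array :: "(nat \<times> nat \<Rightarrow> real) measure" where
  "noise_array \<equiv> PiM wav_indices (\<lambda>_. noise)"

abbreviation coeff_space :: "(nat \<times> nat \<Rightarrow> real) measure" where
  "coeff_space \<equiv> PiM wav_indices (\<lambda>_. borel)"

definition scale_noise :: "(nat \<times> nat \<Rightarrow> real) \<Rightarrow> nat \<times> nat \<Rightarrow> real" where
  "scale_noise \<zeta> = (\<lambda>(l, k)\<in>wav_indices. s l * \<zeta> (l, k))"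

sublocale noise_arrays: product_prob_space "\<lambda>_. noise" wav_indices
  using prob_space_noise by (simp add: product_prob_spaceI)

lemma scale_noise_apply [simp]: "k \<in> wav_idx l \<Longrightarrow> scale_noise \<zeta> (l, k) = s l * \<zeta> (l, k)"
  by (simp add: scale_noise_def)

lemma scale_noise_extensional: "scale_noise \<zeta> \<in> wav_indices \<rightarrow>\<^sub>E UNIV"
  by (simp add: scale_noise_def)

lemma measurable_noise_component:
  "k \<in> wav_idx l \<Longrightarrow> (\<lambda>\<zeta>. \<zeta> (l, k)) \<in> borel_measurable noise_array"
  using measurable_component_singleton[of "(l, k)" wav_indices "\<lambda>_. noise"]
  by (simp cong: measurable_cong_sets)

lemma measurable_scale_noise [measurable]: "scale_noise \<in> measurable noise_array coeff_space"
  unfolding scale_noise_def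
proof (rule measurable_restrict)
  fix i assume "i \<in> wav_indices"
  then obtain l k where "i = (l, k)" "k \<in> wav_idx l"
    by (cases i) simp
  then show "(\<lambda>\<zeta>. case i of (l, k) \<Rightarrow> s l * \<zeta> (l, k)) \<in> borel_measurable noise_array"
    using measurable_noise_component by simp
qed

lemma prior_eq: "prior h s = completion (distr noise_array coeff_space scale_noise)"
  by (simp add: prior_def noise_def scale_noise_def[abs_def])

lemma K_pos: "0 < K"
  using s_pos[of 0] s_upper[of 0] by simp

lemma measure_component:
  assumes "k \<in> wav_idx l" "S \<in> sets borel"
  shows "measure noise_array {\<zeta> \<in> space noise_array. \<zeta> (l, k) \<in> S} = measure noise S"
  using noise_arrays.emeasure_PiM_Collect_single[of "(l, k)" S] assms by (simp add: measure_def)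

text \<open>Some noise variable of level \<open>l\<close> exceeds \<open>t l\<close> with
  probability O(2^(-2 \<eta> l)), which is summable, so Borel-Cantelli applies. The decay exponent 1
  + 2 \<eta> of the scales splits into halves: one absorbs the growth allowed to the noise, the
  other remains as decay of the coefficients.\<close>

lemma AE_scale_noise_regular: "AE \<zeta> in noise_array. scale_noise \<zeta> \<in> regular_coeffs K \<eta>"
proof -
  define t where "t l = 2 powr (real l * (1/2 + \<eta>))" for l
  define V where "V l k = {\<zeta> \<in> space noise_array. \<zeta> (l, k) \<in> {x. t l < \<bar>x\<bar>}}" for l k
  have V: "V l k \<in> sets noise_array" if "k \<in> wav_idx l" for l k
    unfolding V_def using measurable_noise_component[OF that] by measurable
  define U where "U l = (\<Union>k\<in>wav_idx l. V l k)" for l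
  have U: "U l \<in> sets noise_array" for l
    unfolding U_def using V by (intro sets.finite_UN) auto
  have U_le: "norm (measure noise_array (U l)) \<le> 2 * c2 * (2 powr (- 2 * \<eta>)) ^ l" for l
  proof -
    have "1 \<le> t l"
      unfolding t_def using \<eta>_pos by (intro ge_one_powr_ge_zero) auto
    have "measure noise_array (U l) \<le> (\<Sum>k\<in>wav_idx l. measure noise_array (V l k))"
      unfolding U_def using V by (intro measure_UNION_le) auto
    also have "\<dots> \<le> (\<Sum>k\<in>wav_idx l. 2 * c2 / (t l)\<^sup>2)"
      unfolding V_def using measure_noise_tail[OF \<open>1 \<le> t l\<close>] by (intro sum_mono) (subst measure_component, auto)
    also have "\<dots> = 2 * c2 * (2 powr real l / (t l)\<^sup>2)"
      by (simp add: powr_realpow)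
    also have "(t l)\<^sup>2 = 2 powr (real l * (1 + 2 * \<eta>))"
      by (simp add: t_def power2_eq_square powr_add[symmetric] algebra_simps)
    also have "2 powr real l / 2 powr (real l * (1 + 2 * \<eta>)) = 2 powr (- 2 * \<eta> * real l)"
      by (simp add: powr_diff[symmetric] algebra_simps)
    also have "\<dots> = (2 powr (- 2 * \<eta>)) ^ l"
      using powr_powr[of 2 "- 2 * \<eta>" "real l"] by (simp add: powr_realpow)
    finally show ?thesis
      by simp
  qed
  have "summable (\<lambda>l. 2 * c2 * (2 powr (- 2 * \<eta>)) ^ l)"
    using \<eta>_pos by (intro summable_mult summable_geometric) (simp add: powr_less_one)
  then have "summable (\<lambda>l. measure noise_array (U l))"
    by (rule summable_comparison_test'[OF _ U_le])
  then have "AE \<zeta> in noise_array. \<forall>\<^sub>F l in sequentially. \<zeta> \<in> space noise_array - U l"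
    using U by (intro borel_cantelli_AE1) (auto simp: noise_arrays.P.emeasure_eq_measure)
  then show ?thesis
  proof eventually_elim
    case (elim \<zeta>)
    then obtain N where N: "\<And>l. N \<le> l \<Longrightarrow> \<zeta> \<in> space noise_array - U l"
      by (auto simp: eventually_sequentially)
    have "\<bar>scale_noise \<zeta> (l, k)\<bar> \<le> K * 2 powr (- real l * (1/2 + \<eta>))" if "N \<le> l" "k \<in> wav_idx l" for l k
    proof -
      have "\<bar>\<zeta> (l, k)\<bar> \<le> t l"
        using N[OF that(1)] that(2) by (auto simp: U_def V_def not_less)
      then have "s l * \<bar>\<zeta> (l, k)\<bar> \<le> K * 2 powr (- real l * (1 + 2 * \<eta>)) * t l"
        using s_pos[of l] s_upper[of l] K_pos by (intro mult_mono) auto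
      also have "\<dots> = K * 2 powr (- real l * (1/2 + \<eta>))"
        by (simp add: t_def mult.assoc powr_add[symmetric] algebra_simps)
      finally show ?thesis
        using that s_pos[of l] by (simp add: abs_mult)
    qed
    then show ?case
      using scale_noise_extensional by (auto simp: regular_coeffs_def)
  qed
qed

text \<open>The part of the ball inside the regular coefficients is measurable, and the rest lies in
  a null set, hence belongs to the completion.\<close>

lemma sets_prior_sup_ball: "sup_ball \<psi> f0 r \<in> sets (prior h s)"
proof -
  let ?R = "distr noise_array coeff_space scale_noise"
  let ?B = "sup_ball \<psi> f0 r" and ?G = "regular_coeffs K \<eta>"
  have G: "{c \<in> space coeff_space. c \<in> ?G} \<in> sets coeff_space"
    using sets_regular_coeffs[of K \<eta>] by (auto simp: Collect_conj_eq)
  have "AE c in ?R. c \<in> ?G"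
    using AE_scale_noise_regular AE_distr_iff[OF measurable_scale_noise G] by simp
  then have "AE c in ?R. c \<notin> space ?R - ?G"
    by eventually_elim simp
  moreover have "space ?R - ?G \<in> sets ?R"
    using sets_regular_coeffs[of K \<eta>] sets.top[of ?R] by (intro sets.Diff) simp_all
  ultimately have "space ?R - ?G \<in> null_sets ?R"
    using AE_iff_null_sets by blast
  moreover have "?B - ?G \<subseteq> space ?R - ?G"
    by (auto simp: sup_ball_def space_PiM)
  moreover have "?B \<inter> ?G \<in> sets ?R"
    using sup_ball_Int_regular_measurable \<eta>_pos K_pos by simp
  ultimately show ?thesis
    unfolding prior_eq by (intro sets_completionI[where S = "?B \<inter> ?G" and N = "?B - ?G"]) auto
qed

lemma prob_space_prior: "prob_space (prior h s)"
proof -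
  interpret prob_space "distr noise_array coeff_space scale_noise"
    by (intro noise_arrays.P.prob_space_distr measurable_scale_noise)
  show ?thesis
    unfolding prior_eq by (rule prob_space_completion)
qed

lemma measure_sup_ball_mono:
  assumes "r \<le> r'"
  shows "measure (prior h s) (sup_ball \<psi> f0 r) \<le> measure (prior h s) (sup_ball \<psi> f0 r')"
proof -
  interpret prob_space "prior h s" by (rule prob_space_prior)
  have "sup_ball \<psi> f0 r \<subseteq> sup_ball \<psi> f0 r'"
    unfolding sup_ball_def using ennreal_leI[OF assms] by (auto intro: less_le_trans)
  then show ?thesis
    by (intro finite_measure_mono sets_prior_sup_ball)
qed

text \<open>Here \<open>e l\<close> is the cost of one coefficient of level \<open>l\<close>,
  incurred 2^l times by independence. The constant \<open>K'\<close> is free, because the box need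
  not obey the almost sure bound with the constant \<open>K\<close>.\<close>

lemma measure_sup_ball_ge_box:
  assumes S: "\<And>l k. k \<in> wav_idx l \<Longrightarrow> S (l, k) \<in> sets borel"
    and prob: "\<And>l k. k \<in> wav_idx l \<Longrightarrow> exp (- e l) \<le> measure noise (S (l, k))"
    and e: "\<And>N. (\<Sum>l<N. 2 ^ l * e l) \<le> E"
    and box: "\<And>\<zeta>. (\<And>l k. k \<in> wav_idx l \<Longrightarrow> \<zeta> (l, k) \<in> S (l, k)) \<Longrightarrow>
      scale_noise \<zeta> \<in> sup_ball \<psi> f0 r \<inter> regular_coeffs K' \<eta>"
    and "0 \<le> K'"
  shows "exp (- E) \<le> measure (prior h s) (sup_ball \<psi> f0 r)"
proof -
  interpret Pr: prob_space "prior h s" by (rule prob_space_prior)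
  let ?B = "sup_ball \<psi> f0 r \<inter> regular_coeffs K' \<eta>"
  define F where "F N = Sigma {..<N} wav_idx" for N
  have F: "incseq F" "(\<Union>N. F N) = wav_indices" "\<And>N. finite (F N)"
    by (auto simp: F_def incseq_def wav_indices_def)
  have S': "S i \<in> sets noise" if "i \<in> wav_indices" for i
    using S that by (cases i) auto
  have prod: "exp (- E) \<le> (\<Prod>i\<in>F N. measure noise (S i))" for N
  proof -
    have "exp (- E) \<le> exp (\<Sum>l<N. \<Sum>k\<in>wav_idx l. - e l)"
      using e[of N] by (simp add: sum_negf)
    also have "\<dots> = (\<Prod>l<N. \<Prod>k\<in>wav_idx l. exp (- e l))"
      by (simp only: exp_sum finite_wav_idx finite_lessThan)
    also have "\<dots> \<le> (\<Prod>l<N. \<Prod>k\<in>wav_idx l. measure noise (S (l, k)))"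
      using prob by (intro prod_mono conjI prod_nonneg) auto
    also have "\<dots> = (\<Prod>i\<in>F N. measure noise (S i))"
      unfolding F_def by (subst prod.Sigma) auto
    finally show ?thesis .
  qed
  note PiE = noise_arrays.measure_PiM_PiE_ge[OF F S' prod]
  have B: "?B \<in> sets coeff_space"
    using sup_ball_Int_regular_measurable \<eta>_pos \<open>0 \<le> K'\<close> by simp
  have "exp (- E) \<le> measure noise_array (Pi\<^sub>E wav_indices S)"
    by (rule PiE(2))
  also have "\<dots> \<le> measure noise_array (scale_noise -` ?B \<inter> space noise_array)"
    using box sets.sets_into_space[OF PiE(1)] measurable_sets[OF measurable_scale_noise B]
    by (intro noise_arrays.P.finite_measure_mono) (auto simp: PiE_def Pi_iff)
  also have "\<dots> = measure (distr noise_array coeff_space scale_noise) ?B"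
    by (rule measure_distr[symmetric, OF measurable_scale_noise B])
  also have "\<dots> = measure (prior h s) ?B"
    unfolding prior_eq using B by (subst measure_completion) auto
  also have "\<dots> \<le> measure (prior h s) (sup_ball \<psi> f0 r)"
    by (intro Pr.finite_measure_mono sets_prior_sup_ball) auto
  finally show ?thesis .
qed

end

subsection \<open>Probability of small balls at a fixed resolution\<close>

text \<open>The second-order term in the lower bound -x - 2 x^2 for ln (1 - x) is absorbed when x is
  at most 1/2. This converts a tail bound into an exponential lower bound for the complementary
  event.\<close>

lemma exp_minus_double_le:
  fixes x :: real
  assumes "0 \<le> x" "x \<le> 1/2"
  shows "exp (- (2 * x)) \<le> 1 - x"
proof -
  have "2 * x\<^sup>2 \<le> x"
    using mult_left_mono[of x "1/2" x] assms by (simp add: power2_eq_square)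
  then have "- (2 * x) \<le> ln (1 - x)"
    using ln_one_minus_pos_lower_bound[OF assms] by linarith
  then have "exp (- (2 * x)) \<le> exp (ln (1 - x))"
    by simp
  then show ?thesis
    using assms by simp
qed

context prior_setup
begin

text \<open>The first summand pays for the length of the interval, the second for the density at its
  far end. The number \<open>L + 2\<close> bounds \<open>s l + \<bar>b l k\<bar> + \<delta>\<close>,
  with \<delta> the tolerance at level \<open>J\<close>.\<close>

definition low_exponent :: real where
  "low_exponent = (1/2 + \<beta>) + c1 * (1 + (ln (L + 2) + A) powr (1 + \<kappa>))"

lemma low_exponent_nonneg: "0 \<le> low_exponent"
  using \<beta>_pos const_ranges by (simp add: low_exponent_def)

text \<open>Division by \<open>s l\<close> turns the event into an interval around
  \<open>b l k / s l\<close>. Its far end is of order at most \<open>1 / s l\<close>, whose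
  logarithm is O((1 + J)^p); the power 1 + \<kappa> in \<open>h_lower\<close> then produces p (1 +
  \<kappa>). This exponent is at least 1, so it also dominates the cost O(J) of the length.\<close>

lemma low_level_prob:
  assumes "l < J" "k \<in> wav_idx l"
  defines "\<delta> \<equiv> 2 powr (- real J * (1/2 + \<beta>))"
  shows "exp (- (low_exponent * (1 + real J) powr (p * (1 + \<kappa>)))) \<le> measure noise {z. \<bar>s l * z - b l k\<bar> \<le> \<delta>}"
proof -
  let ?q = "p * (1 + \<kappa>)" and ?A = "ln (L + 2) + A"
  have s: "0 < s l" "s l \<le> 1"
    using s_pos s_le_1 by auto
  have \<delta>: "0 < \<delta>" "\<delta> \<le> 1"
    using \<beta>_pos by (auto simp: \<delta>_def intro!: powr_le_one_le powr_mono[of _ 0 2, simplified] mult_nonpos_nonneg)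
  have b: "\<bar>b l k\<bar> \<le> L"
  proof -
    have "2 powr (- real l * (1/2 + \<beta>)) \<le> 2 powr (0::real)"
      using \<beta>_pos by (intro powr_mono mult_nonpos_nonneg) auto
    then have "L * 2 powr (- real l * (1/2 + \<beta>)) \<le> L"
      using L_pos by (simp add: mult_le_cancel_left1)
    then show ?thesis
      using b_bound[OF assms(2)] by linarith
  qed
  have q: "1 \<le> ?q"
    using p_ge_1 const_ranges mult_mono[of 1 p 1 "1 + \<kappa>"] by simp
  have A: "0 \<le> ?A"
    using L_pos A_nonneg by simp
  have "1 + (\<bar>b l k / s l\<bar> + \<delta> / s l) \<le> (L + 2) / s l"
  proof -
    have "1 + (\<bar>b l k / s l\<bar> + \<delta> / s l) = (s l + \<bar>b l k\<bar> + \<delta>) / s l"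
      using s by (simp add: field_simps)
    also have "\<dots> \<le> (L + 2) / s l"
      using s b \<delta> by (intro divide_right_mono) auto
    finally show ?thesis .
  qed
  then have "ln (1 + (\<bar>b l k / s l\<bar> + \<delta> / s l)) \<le> ln ((L + 2) / s l)"
    using s \<delta> by (intro ln_mono) (auto intro!: add_pos_nonneg)
  also have "\<dots> = ln (L + 2) + - ln (s l)"
    using s L_pos by (simp add: ln_div)
  also have "\<dots> \<le> ln (L + 2) * (1 + real J) powr p + A * (1 + real J) powr p"
  proof (rule add_mono)
    show "ln (L + 2) \<le> ln (L + 2) * (1 + real J) powr p"
      using L_pos p_ge_1 by (simp add: mult_le_cancel_left1 ge_one_powr_ge_zero)
    have "A * (1 + real l) powr p \<le> A * (1 + real J) powr p"
      using A_nonneg p_ge_1 assms(1) by (intro mult_left_mono powr_mono2) auto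
    then show "- ln (s l) \<le> A * (1 + real J) powr p"
      using s_lower[of l] by linarith
  qed
  also have "\<dots> = ?A * (1 + real J) powr p"
    by (simp add: distrib_right)
  finally have "ln (1 + (\<bar>b l k / s l\<bar> + \<delta> / s l)) powr (1 + \<kappa>) \<le> (?A * (1 + real J) powr p) powr (1 + \<kappa>)"
    using const_ranges s \<delta> by (intro powr_mono2) (auto intro!: ln_ge_zero)
  also have "\<dots> = ?A powr (1 + \<kappa>) * (1 + real J) powr ?q"
    using A by (simp add: powr_mult powr_powr)
  finally have ln_powr: "ln (1 + (\<bar>b l k / s l\<bar> + \<delta> / s l)) powr (1 + \<kappa>) \<le> \<dots>" .
  have Jq: "1 \<le> (1 + real J) powr ?q"
    using q by (intro ge_one_powr_ge_zero) auto
  have J_le: "real J \<le> (1 + real J) powr ?q"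
    using powr_mono[OF q, of "1 + real J"] by simp
  have "- ln \<delta> \<le> (1/2 + \<beta>) * real J"
  proof -
    have "- ln \<delta> = (1/2 + \<beta>) * real J * ln 2"
      by (simp add: \<delta>_def ln_powr)
    also have "\<dots> \<le> (1/2 + \<beta>) * real J * 1"
      using ln_2_less_1 \<beta>_pos by (intro mult_left_mono) auto
    finally show ?thesis by simp
  qed
  also have "(1/2 + \<beta>) * real J \<le> (1/2 + \<beta>) * (1 + real J) powr ?q"
    using J_le \<beta>_pos by (intro mult_left_mono) auto
  finally have ln_\<delta>: "- ln \<delta> \<le> (1/2 + \<beta>) * (1 + real J) powr ?q" .
  have "c1 * (1 + ln (1 + (\<bar>b l k / s l\<bar> + \<delta> / s l)) powr (1 + \<kappa>))
      \<le> c1 * ((1 + ?A powr (1 + \<kappa>)) * (1 + real J) powr ?q)"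
    using ln_powr Jq const_ranges by (intro mult_left_mono) (auto simp: distrib_right)
  then have "- (low_exponent * (1 + real J) powr ?q)
      \<le> ln \<delta> + - (c1 * (1 + ln (1 + (\<bar>b l k / s l\<bar> + \<delta> / s l)) powr (1 + \<kappa>)))"
    using ln_\<delta> by (simp add: low_exponent_def algebra_simps)
  then have "exp (- (low_exponent * (1 + real J) powr ?q))
      \<le> exp (ln \<delta> + - (c1 * (1 + ln (1 + (\<bar>b l k / s l\<bar> + \<delta> / s l)) powr (1 + \<kappa>))))"
    by (simp only: exp_le_cancel_iff)
  also have "\<dots> = \<delta> * exp (- (c1 * (1 + ln (1 + (\<bar>b l k / s l\<bar> + \<delta> / s l)) powr (1 + \<kappa>))))"
    using \<delta> by (simp only: exp_add exp_ln)
  \<comment> \<open>The length of the interval is at least \<delta> because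
    \<open>s l \<le> 1\<close>; the gain from a small scale is discarded.\<close>
  also have "\<dots> \<le> 2 * (\<delta> / s l) * exp (- (c1 * (1 + ln (1 + (\<bar>b l k / s l\<bar> + \<delta> / s l)) powr (1 + \<kappa>))))"
    using s \<delta> by (intro mult_right_mono) (auto simp: field_simps)
  also have "\<dots> \<le> measure noise {z. \<bar>z - b l k / s l\<bar> \<le> \<delta> / s l}"
    using s \<delta> by (intro measure_noise_cball_ge) auto
  also have "{z. \<bar>z - b l k / s l\<bar> \<le> \<delta> / s l} = {z. \<bar>s l * z - b l k\<bar> \<le> \<delta>}"
  proof -
    have "\<bar>s l * z - b l k\<bar> = s l * \<bar>z - b l k / s l\<bar>" for z
      using s abs_mult_pos[of "s l" "z - b l k / s l"] by (simp add: right_diff_distrib mult.commute)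
    then show ?thesis
      using s by (simp add: field_simps)
  qed
  finally show ?thesis .
qed

text \<open>The summand \<open>4 * c2\<close> makes twice the tail bound at
  \<open>high_radius * u\<close> at most 1 / u^2; the added 1 keeps the radius at least 1, where
  \<open>h_tail\<close> applies.\<close>

definition high_radius :: real where
  "high_radius = sqrt (4 * c2 + 1)"

text \<open>Here \<open>m\<close> stands for \<open>l - J\<close>. A cost of 2^(-(1 + 2 \<eta>) m)
  per coefficient amounts to 2^J 2^(-2 \<eta> m) for the whole level, which is summable over
  \<open>m\<close>.\<close>

lemma high_level_prob:
  "exp (- ((2 powr (- (1 + 2 * \<eta>))) ^ m)) \<le> measure noise {z. \<bar>z\<bar> \<le> high_radius * 2 powr (real m * (1/2 + \<eta>))}"
proof -
  define u where "u = 2 powr (real m * (1/2 + \<eta>))"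
  let ?t = "high_radius * u"
  have u: "1 \<le> u"
    unfolding u_def using \<eta>_pos by (intro ge_one_powr_ge_zero) auto
  have T: "1 \<le> high_radius" "high_radius\<^sup>2 = 4 * c2 + 1"
    using const_ranges by (auto simp: high_radius_def)
  have t: "1 \<le> ?t"
    using mult_mono[OF T(1) u] T by simp
  define x where "x = 2 * c2 / ?t\<^sup>2"
  have x_le: "2 * x \<le> 1 / u\<^sup>2"
    using u T const_ranges by (simp add: x_def power_mult_distrib divide_simps)
  have "1 / u\<^sup>2 \<le> 1"
    using u by simp
  then have x: "0 \<le> x" "x \<le> 1/2"
    using x_le const_ranges by (auto simp: x_def)
  have "u\<^sup>2 = (2 powr (1 + 2 * \<eta>)) ^ m"
    using powr_powr[of 2 "1 + 2 * \<eta>" "real m"]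
    by (simp add: u_def powr_realpow power2_eq_square powr_add[symmetric] algebra_simps)
  then have "1 / u\<^sup>2 = (2 powr (- (1 + 2 * \<eta>))) ^ m"
    by (simp add: powr_minus_divide power_one_over del: minus_add_distrib)
  then have "exp (- ((2 powr (- (1 + 2 * \<eta>))) ^ m)) \<le> exp (- (2 * x))"
    using x_le by simp
  also have "\<dots> \<le> 1 - x"
    by (rule exp_minus_double_le[OF x])
  also have "\<dots> \<le> 1 - measure noise {z. ?t < \<bar>z\<bar>}"
    using measure_noise_tail[OF t] by (simp add: x_def)
  also have "\<dots> = measure noise (space noise - {z. ?t < \<bar>z\<bar>})"
    by (subst noise_arrays.M.prob_compl) auto
  also have "space noise - {z. ?t < \<bar>z\<bar>} = {z. \<bar>z\<bar> \<le> ?t}"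
    by auto
  finally show ?thesis
    by (simp add: u_def)
qed

text \<open>The ratio \<open>q\<close> is the slowest of three decays away from \<open>J\<close>:
  exponent 1/2 from the localisation factor below \<open>J\<close>, and \<eta> from the prior and
  \<beta> from the target above it. The final 1 in \<open>d\<close> makes room for the strict
  inequality.\<close>

lemma small_ball_radius:
  assumes low: "\<And>l k. l < J \<Longrightarrow> k \<in> wav_idx l \<Longrightarrow> \<bar>s l * \<zeta> (l, k) - b l k\<bar> \<le> 2 powr (- real J * (1/2 + \<beta>))"
    and high: "\<And>l k. J \<le> l \<Longrightarrow> k \<in> wav_idx l \<Longrightarrow> \<bar>\<zeta> (l, k)\<bar> \<le> T * 2 powr (real (l - J) * (1/2 + \<eta>))"
    and T: "0 \<le> T"
  defines "q \<equiv> 2 powr (- min (1/2) (min \<eta> \<beta>))"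
  defines "d \<equiv> C * (1 + K * T + L) * (2 / (1 - q)) + 1"
  shows "scale_noise \<zeta> \<in> sup_ball \<psi> f0 (d * 2 powr (- real J * \<beta>)) \<inter> regular_coeffs (K * T) \<eta>"
proof -
  let ?c = "scale_noise \<zeta>" and ?\<epsilon> = "2 powr (- real J * \<beta>)" and ?\<rho> = "min (1/2) (min \<eta> \<beta>)"
  have KT: "0 \<le> K * T"
    using K_pos T by simp
  have \<rho>: "0 < ?\<rho>"
    using \<eta>_pos \<beta>_pos by simp
  then have q: "0 < q" "q < 1"
    by (auto simp: q_def intro: powr_less_one)
  have q_powr: "q ^ m = 2 powr (- ?\<rho> * real m)" for m
    using powr_powr[of 2 "- ?\<rho>" "real m"] by (simp add: q_def powr_realpow)
  have c_high: "\<bar>?c (l, k)\<bar> \<le> K * T * 2 powr (- real l * (1 + 2 * \<eta>) + real (l - J) * (1/2 + \<eta>))"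
    if "J \<le> l" "k \<in> wav_idx l" for l k
  proof -
    have "\<bar>?c (l, k)\<bar> = s l * \<bar>\<zeta> (l, k)\<bar>"
      using that s_pos[of l] by (simp add: abs_mult)
    also have "\<dots> \<le> K * 2 powr (- real l * (1 + 2 * \<eta>)) * (T * 2 powr (real (l - J) * (1/2 + \<eta>)))"
      using high[OF that] s_upper[of l] s_pos[of l] K_pos by (intro mult_mono) auto
    finally show ?thesis
      unfolding powr_add by (simp only: mult_ac)
  qed
  have "\<bar>?c (l, k)\<bar> \<le> K * T * 2 powr (- real l * (1/2 + \<eta>))" if "J \<le> l" "k \<in> wav_idx l" for l k
  proof -
    have "real (l - J) * (1/2 + \<eta>) \<le> real l * (1/2 + \<eta>)"
      using \<eta>_pos by (intro mult_right_mono) auto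
    then have "- real l * (1 + 2 * \<eta>) + real (l - J) * (1/2 + \<eta>) \<le> - real l * (1/2 + \<eta>)"
      by (simp add: algebra_simps)
    then have "2 powr (- real l * (1 + 2 * \<eta>) + real (l - J) * (1/2 + \<eta>)) \<le> 2 powr (- real l * (1/2 + \<eta>))"
      by (intro powr_mono) auto
    then show ?thesis
      by (rule order.trans[OF c_high[OF that] mult_left_mono[OF _ KT]])
  qed
  then have regular: "?c \<in> regular_coeffs (K * T) \<eta>"
    using scale_noise_extensional by (auto simp: regular_coeffs_def)
  define G where "G = C * (1 + K * T + L) * ?\<epsilon>"
  have G: "0 \<le> G"
    using C_pos KT L_pos by (simp add: G_def)
  have level_low: "\<bar>\<Sum>k\<in>wav_idx l. (?c (l, k) - b l k) * \<psi> l k x\<bar> \<le> G * q ^ (J - l)"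
    if "x \<in> {0..1}" "l < J" for x l
  proof -
    have "\<bar>\<Sum>k\<in>wav_idx l. (?c (l, k) - b l k) * \<psi> l k x\<bar>
        \<le> C * (2 powr (- real J * (1/2 + \<beta>)) * 2 powr (real l / 2))"
      using low that by (intro level_bound) auto
    also have "2 powr (- real J * (1/2 + \<beta>)) * 2 powr (real l / 2) = ?\<epsilon> * 2 powr (- (1/2) * real (J - l))"
      using that by (simp add: powr_add[symmetric] of_nat_diff algebra_simps diff_divide_distrib)
    also have "2 powr (- (1/2) * real (J - l)) \<le> q ^ (J - l)"
      unfolding q_powr by (intro powr_mono mult_right_mono) auto
    also have "C * (?\<epsilon> * q ^ (J - l)) \<le> C * ((1 + K * T + L) * (?\<epsilon> * q ^ (J - l)))"
      using C_pos KT L_pos q by (intro mult_left_mono) (auto simp: distrib_right)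
    finally show ?thesis
      using C_pos by (simp add: G_def mult_ac)
  qed
  have level_high: "\<bar>\<Sum>k\<in>wav_idx l. (?c (l, k) - b l k) * \<psi> l k x\<bar> \<le> G * q ^ (l - J)"
    if x: "x \<in> {0..1}" and l: "J \<le> l" for x l
  proof -
    define v where "v = 2 powr (- real l * (1 + 2 * \<eta>) + real (l - J) * (1/2 + \<eta>))"
    define w where "w = 2 powr (- real l * (1/2 + \<beta>))"
    have "\<bar>\<Sum>k\<in>wav_idx l. (?c (l, k) - b l k) * \<psi> l k x\<bar>
        \<le> C * ((K * T * v + L * w) * 2 powr (real l / 2))"
    proof (rule level_bound[OF _ x])
      fix k assume k: "k \<in> wav_idx l"
      show "\<bar>?c (l, k) - b l k\<bar> \<le> K * T * v + L * w"
        using c_high[OF l k] b_bound[OF k] unfolding v_def w_def by linarith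
    qed
    also have "(K * T * v + L * w) * 2 powr (real l / 2)
        = K * T * (v * 2 powr (real l / 2)) + L * (w * 2 powr (real l / 2))"
      by (simp add: algebra_simps)
    also have "\<dots> \<le> K * T * (?\<epsilon> * q ^ (l - J)) + L * (?\<epsilon> * q ^ (l - J))"
    proof (intro add_mono mult_left_mono KT)
      have l_eq: "real l = real J + real (l - J)"
        using l by simp
      have \<rho>_le: "real (l - J) * ?\<rho> \<le> real (l - J) * \<eta>" "real (l - J) * ?\<rho> \<le> real (l - J) * \<beta>"
        by (intro mult_left_mono; simp)+
      \<comment> \<open>At \<open>l = J\<close> the prior contributes a multiple of 2^(-J (1/2 + 2
        \<eta>)), which \<open>\<beta>_le\<close> keeps below the same multiple of 2^(-J \<beta>);
        each further level gains a factor 2^(-\<eta>).\<close>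
      have "real J * \<beta> \<le> real J * (1/2 + 2 * \<eta>)"
        using \<beta>_le by (intro mult_left_mono) auto
      then have "- real l * (1 + 2 * \<eta>) + real (l - J) * (1/2 + \<eta>) + real l / 2 \<le> - real J * \<beta> + - ?\<rho> * real (l - J)"
        using \<rho>_le(1) by (simp add: l_eq algebra_simps add_divide_distrib diff_divide_distrib)
      then show "v * 2 powr (real l / 2) \<le> ?\<epsilon> * q ^ (l - J)"
        unfolding v_def q_powr powr_add[symmetric] by (intro powr_mono) auto
      have "- real l * (1/2 + \<beta>) + real l / 2 \<le> - real J * \<beta> + - ?\<rho> * real (l - J)"
        using \<rho>_le(2) by (simp add: l_eq algebra_simps add_divide_distrib diff_divide_distrib)
      then show "w * 2 powr (real l / 2) \<le> ?\<epsilon> * q ^ (l - J)"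
        unfolding w_def q_powr powr_add[symmetric] by (intro powr_mono) auto
      show "0 \<le> L"
        using L_pos by simp
    qed
    also have "\<dots> \<le> (1 + K * T + L) * (?\<epsilon> * q ^ (l - J))"
      using q by (simp add: distrib_right)
    finally show ?thesis
      using C_pos by (simp add: G_def mult_ac)
  qed
  have "\<bar>\<Sum>l. \<Sum>k\<in>wav_idx l. (?c (l, k) - b l k) * \<psi> l k x\<bar> \<le> G * (2 / (1 - q))" if "x \<in> {0..1}" for x
    using level_low[OF that] level_high[OF that]
    by (intro abs_suminf_le sum_two_sided_geometric_le[OF q G, of J])
  then have "(SUP x\<in>{0..1}. ennreal \<bar>\<Sum>l. \<Sum>k\<in>wav_idx l. (?c (l, k) - b l k) * \<psi> l k x\<bar>)
      \<le> ennreal (G * (2 / (1 - q)))"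
    by (intro SUP_least ennreal_leI)
  also have "\<dots> < ennreal (G * (2 / (1 - q)) + ?\<epsilon>)"
    using G q by (intro ennreal_lessI add_nonneg_pos) auto
  also have "G * (2 / (1 - q)) + ?\<epsilon> = d * ?\<epsilon>"
    unfolding d_def G_def distrib_right[of _ 1] by (simp only: mult_1 mult_ac)
  finally show ?thesis
    using mem_sup_ball_iff[OF regular \<eta>_pos] regular by simp
qed

lemma small_ball:
  obtains B d where "0 < B" "0 < d"
    "\<And>J. exp (- (B * (1 + real J) powr (p * (1 + \<kappa>)) * 2 ^ J))
      \<le> measure (prior h s) (sup_ball \<psi> f0 (d * 2 powr (- real J * \<beta>)))"
proof -
  \<comment> \<open>Going down from \<open>J\<close>, the number of coefficients halves at each
    level; going up, the total cost of a level shrinks by 2^(-2 \<eta>). The larger ratio serves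
    both sides.\<close>
  define q where "q = max (1/2) (2 powr (- (2 * \<eta>)))"
  have q: "0 < q" "q < 1"
    using \<eta>_pos by (auto simp: q_def intro: powr_less_one)
  \<comment> \<open>The added 1 covers the levels from \<open>J\<close> on, whose costs have
    constant 1, and makes \<open>B\<close> positive.\<close>
  define B where "B = (low_exponent + 1) * (2 / (1 - q))"
  define d where "d = C * (1 + K * high_radius + L) * (2 / (1 - 2 powr (- min (1/2) (min \<eta> \<beta>)))) + 1"
  have T: "0 \<le> high_radius"
    using const_ranges by (simp add: high_radius_def)
  have "0 < B"
    using low_exponent_nonneg q by (auto simp: B_def)
  moreover have "0 < d"
  proof -
    have "2 powr (- min (1/2) (min \<eta> \<beta>)) < 1"
      using \<eta>_pos \<beta>_pos by (intro powr_less_one) auto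
    then show ?thesis
      using C_pos K_pos T L_pos unfolding d_def by (intro add_nonneg_pos mult_nonneg_nonneg) auto
  qed
  moreover have "exp (- (B * (1 + real J) powr (p * (1 + \<kappa>)) * 2 ^ J))
      \<le> measure (prior h s) (sup_ball \<psi> f0 (d * 2 powr (- real J * \<beta>)))" for J
  proof -
    define Q where "Q = (1 + real J) powr (p * (1 + \<kappa>))"
    have Q: "1 \<le> Q"
      unfolding Q_def using p_ge_1 const_ranges by (intro ge_one_powr_ge_zero) auto
    define S where "S = (\<lambda>(l, k). if l < J then {z. \<bar>s l * z - b l k\<bar> \<le> 2 powr (- real J * (1/2 + \<beta>))}
      else {z. \<bar>z\<bar> \<le> high_radius * 2 powr (real (l - J) * (1/2 + \<eta>))})"
    define e where "e l = (if l < J then low_exponent * Q else (2 powr (- (1 + 2 * \<eta>))) ^ (l - J))" for l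
    have "exp (- ((low_exponent + 1) * Q * 2 ^ J * (2 / (1 - q))))
        \<le> measure (prior h s) (sup_ball \<psi> f0 (d * 2 powr (- real J * \<beta>)))"
    proof (rule measure_sup_ball_ge_box[where S = S and e = e and K' = "K * high_radius"])
      fix l k assume k: "k \<in> wav_idx l"
      show "S (l, k) \<in> sets borel"
        by (auto simp: S_def)
      show "exp (- e l) \<le> measure noise (S (l, k))"
      proof (cases "l < J")
        case True
        then show ?thesis
          using low_level_prob[OF True k] by (simp add: S_def e_def Q_def)
      next
        case False
        then show ?thesis
          using high_level_prob[of "l - J"] by (simp add: S_def e_def)
      qed
    next
      fix N
      show "(\<Sum>l<N. 2 ^ l * e l) \<le> (low_exponent + 1) * Q * 2 ^ J * (2 / (1 - q))"
      proof (rule sum_two_sided_geometric_le[OF q])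
        show "0 \<le> (low_exponent + 1) * Q * 2 ^ J"
          using low_exponent_nonneg Q by simp
      next
        fix l assume l: "l < J"
        have "2 ^ l = 2 ^ J * (1/2 :: real) ^ (J - l)"
          using l by (simp add: power_one_over power_diff)
        also have "\<dots> \<le> 2 ^ J * q ^ (J - l)"
          by (intro mult_left_mono power_mono) (auto simp: q_def)
        finally have "2 ^ l * (low_exponent * Q) \<le> 2 ^ J * q ^ (J - l) * ((low_exponent + 1) * Q)"
          using low_exponent_nonneg Q q by (intro mult_mono) (auto simp: distrib_right)
        then show "2 ^ l * e l \<le> (low_exponent + 1) * Q * 2 ^ J * q ^ (J - l)"
          using l by (simp add: e_def mult_ac)
      next
        fix l assume l: "J \<le> l"
        have "2 ^ l * e l = 2 ^ J * (2 * 2 powr (- (1 + 2 * \<eta>))) ^ (l - J)"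
          using l by (simp add: e_def power_mult_distrib power_add[symmetric] del: minus_add_distrib)
        also have "2 * 2 powr (- (1 + 2 * \<eta>)) = 2 powr (- (2 * \<eta>))"
          using powr_add[of 2 1 "- (1 + 2 * \<eta>)"] by simp
        also have "2 ^ J * (2 powr (- (2 * \<eta>))) ^ (l - J) \<le> 1 * (2 ^ J * q ^ (l - J))"
          unfolding mult_1 by (intro mult_left_mono power_mono) (auto simp: q_def)
        also have "1 * (2 ^ J * q ^ (l - J)) \<le> (low_exponent + 1) * Q * (2 ^ J * q ^ (l - J))"
          using mult_mono[of 1 "low_exponent + 1" 1 Q] low_exponent_nonneg Q q
          by (intro mult_right_mono) auto
        finally show "2 ^ l * e l \<le> (low_exponent + 1) * Q * 2 ^ J * q ^ (l - J)"
          by (simp add: mult_ac)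
      qed
    next
      fix \<zeta> assume \<zeta>: "\<And>l k. k \<in> wav_idx l \<Longrightarrow> \<zeta> (l, k) \<in> S (l, k)"
      show "scale_noise \<zeta> \<in> sup_ball \<psi> f0 (d * 2 powr (- real J * \<beta>)) \<inter> regular_coeffs (K * high_radius) \<eta>"
        unfolding d_def
      proof (rule small_ball_radius[OF _ _ T])
        show "\<bar>s l * \<zeta> (l, k) - b l k\<bar> \<le> 2 powr (- real J * (1/2 + \<beta>))" if "l < J" "k \<in> wav_idx l" for l k
          using \<zeta>[OF that(2)] that(1) by (simp add: S_def)
        show "\<bar>\<zeta> (l, k)\<bar> \<le> high_radius * 2 powr (real (l - J) * (1/2 + \<eta>))" if "J \<le> l" "k \<in> wav_idx l" for l k
          using \<zeta>[OF that(2)] that(1) by (simp add: S_def)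
      qed
    qed (use K_pos T in simp)
    moreover have "B * Q * 2 ^ J = (low_exponent + 1) * Q * 2 ^ J * (2 / (1 - q))"
      unfolding B_def by (simp only: mult_ac)
    ultimately show ?thesis
      unfolding Q_def[symmetric] by (simp only:)
  qed
  ultimately show ?thesis
    by (rule that)
qed

end

subsection \<open>Choice of the resolution\<close>

definition base_rate :: "real \<Rightarrow> real \<Rightarrow> nat \<Rightarrow> real" where
  "base_rate q \<beta> n = (ln (real n) powr q / real n) powr (\<beta> / (1 + 2 * \<beta>))"

text \<open>With y = n / ln^q n the rate is y^(-\<beta>/(1 + 2 \<beta>)), so y times its square is
  y^(1/(1 + 2 \<beta>)). This is the balance with the cost J^q 2^J when 2^J has the order of y^(1/(1
  + 2 \<beta>)).\<close>

lemma n_base_rate_sq: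
  assumes "0 < \<beta>" "0 < ln (real n)"
  shows "real n * (base_rate q \<beta> n)\<^sup>2 = ln (real n) powr q * (real n / ln (real n) powr q) powr (1 / (1 + 2 * \<beta>))"
proof -
  define y where "y = real n / ln (real n) powr q"
  have n: "0 < real n"
    using assms(2) by (cases "n = 0") auto
  have y: "0 < y" "real n = ln (real n) powr q * y" "ln (real n) powr q / real n = y powr (-1)"
    using n assms by (auto simp: y_def powr_minus_divide)
  let ?e = "-1 * (\<beta> / (1 + 2 * \<beta>))"
  have "y * (base_rate q \<beta> n)\<^sup>2 = y powr 1 * (y powr ?e * y powr ?e)"
    using y(1) by (simp only: base_rate_def y(3) powr_powr power2_eq_square powr_one)
  also have "\<dots> = y powr (1 + (?e + ?e))"
    by (simp only: powr_add)
  also have "1 + (?e + ?e) = 1 / (1 + 2 * \<beta>)"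
    using assms by (simp add: divide_simps)
  finally have "y * (base_rate q \<beta> n)\<^sup>2 = y powr (1 / (1 + 2 * \<beta>))" .
  then show ?thesis
    unfolding y_def[symmetric] using y(2) by (metis mult.assoc)
qed

lemma filterlim_resolution:
  assumes "0 < c" "0 < a"
  shows "filterlim (\<lambda>n. c * (real n / ln (real n) powr q) powr a) at_top sequentially"
  using assms by real_asymp

context prior_setup
begin

lemma small_ball_base_rate:
  assumes "0 < d2"
  obtains d1 where "0 < d1"
    "\<forall>\<^sub>F n in sequentially. exp (- d2 * real n * (base_rate (p * (1 + \<kappa>)) \<beta> n)\<^sup>2)
      \<le> measure (prior h s) (sup_ball \<psi> f0 (d1 * base_rate (p * (1 + \<kappa>)) \<beta> n))"
proof -
  let ?q = "p * (1 + \<kappa>)" and ?a = "1 / (1 + 2 * \<beta>)"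
  obtain B d where B: "0 < B" and d: "0 < d"
    and ball: "\<And>J. exp (- (B * (1 + real J) powr ?q * 2 ^ J))
      \<le> measure (prior h s) (sup_ball \<psi> f0 (d * 2 powr (- real J * \<beta>)))"
    using small_ball by blast
  \<comment> \<open>The second entry brings the cost down to \<open>d2\<close>, the factor
    \<open>2 powr ?q\<close> coming from 1 + J \<le> 2 ln n. The first entry ensures
    \<open>M n \<le> n\<close>, on which that bound for \<open>J\<close> rests.\<close>
  define c where "c = min 1 (d2 / (B * 2 powr ?q))"
  have c: "0 < c" "c \<le> 1" "B * 2 powr ?q * c \<le> d2"
    using B assms by (auto simp: c_def min_def field_simps)
  define y where "y n = real n / ln (real n) powr ?q" for n :: nat
  define M where "M n = c * y n powr ?a" for n
  have q: "1 \<le> ?q"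
    using p_ge_1 const_ranges mult_mono[of 1 p 1 "1 + \<kappa>"] by simp
  have a: "0 < ?a" "?a \<le> 1"
    using \<beta>_pos by auto
  have "filterlim M at_top sequentially"
    unfolding M_def y_def using c a by (intro filterlim_resolution)
  then have "\<forall>\<^sub>F n in sequentially. 1 \<le> M n"
    by (simp add: filterlim_at_top)
  moreover have "\<forall>\<^sub>F n in sequentially. 2 \<le> ln (real n)"
    by real_asymp
  ultimately have "\<forall>\<^sub>F n in sequentially. exp (- d2 * real n * (base_rate ?q \<beta> n)\<^sup>2)
      \<le> measure (prior h s) (sup_ball \<psi> f0 (d * (c / 2) powr (- \<beta>) * base_rate ?q \<beta> n))"
  proof eventually_elim
    case (elim n)
    have "0 < real n"
      using elim(2) by (cases "n = 0") auto
    then have n: "1 \<le> real n"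
      by simp
    have lnq: "1 \<le> ln (real n) powr ?q"
      using elim(2) q by (intro ge_one_powr_ge_zero) auto
    have y: "0 < y n" "y n \<le> real n"
      using n lnq mult_left_mono[OF lnq, of "real n"]
      by (auto simp: y_def divide_le_eq intro!: divide_pos_pos simp del: of_nat_le_iff)
    \<comment> \<open>Rounding down gives M/2 \<le> 2^J \<le> M. The upper bound controls the
      probability, the lower one the radius, whence \<open>c / 2\<close> in the final
      constant.\<close>
    define J where "J = nat \<lfloor>log 2 (M n)\<rfloor>"
    have J: "real J = of_int \<lfloor>log 2 (M n)\<rfloor>"
      using elim(1) by (simp add: J_def)
    have J_le: "real J \<le> log 2 (M n)" and J_gt: "log 2 (M n) - 1 \<le> real J"
      unfolding J by linarith+
    have "2 powr real J \<le> 2 powr (log 2 (M n))"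
      using J_le by (intro powr_mono) auto
    then have J_M: "2 ^ J \<le> M n"
      using elim(1) by (simp add: powr_realpow)
    have "2 powr (log 2 (M n) - 1) \<le> 2 powr real J"
      using J_gt by (intro powr_mono) auto
    then have M_J: "M n / 2 \<le> 2 powr real J"
      using elim(1) by (simp add: powr_diff)
    have "M n \<le> 1 * real n powr 1"
      unfolding M_def using c y a n
      by (intro mult_mono order.trans[OF powr_mono2[of _ _ "real n"] powr_mono]) auto
    then have "log 2 (M n) \<le> log 2 (real n)"
      using elim(1) by (intro log_mono) auto
    also have "\<dots> = ln (real n) / ln 2"
      by (simp add: log_def)
    also have "\<dots> \<le> ln (real n) / (2/3)"
      using ln2_ge_two_thirds elim(2) by (intro divide_left_mono) auto
    \<comment> \<open>The inequality 1 + (3/2) ln n \<le> 2 ln n amounts to ln n \<ge> 2.\<close>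
    finally have "1 + real J \<le> 2 * ln (real n)"
      using J_le elim(2) by simp
    then have "(1 + real J) powr ?q \<le> (2 * ln (real n)) powr ?q"
      using q by (intro powr_mono2) auto
    then have "B * (1 + real J) powr ?q * 2 ^ J \<le> B * (2 * ln (real n)) powr ?q * M n"
      using B J_M by (intro mult_mono) auto
    also have "\<dots> = (B * 2 powr ?q * c) * (ln (real n) powr ?q * y n powr ?a)"
      using elim(2) by (simp add: M_def powr_mult)
    also have "\<dots> \<le> d2 * (ln (real n) powr ?q * y n powr ?a)"
      using c(3) by (intro mult_right_mono) auto
    also have "ln (real n) powr ?q * y n powr ?a = real n * (base_rate ?q \<beta> n)\<^sup>2"
      unfolding y_def using \<beta>_pos elim(2) by (intro n_base_rate_sq[symmetric]) auto
    finally have "exp (- d2 * real n * (base_rate ?q \<beta> n)\<^sup>2) \<le> exp (- (B * (1 + real J) powr ?q * 2 ^ J))"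
      by (simp add: mult.assoc)
    also have "\<dots> \<le> measure (prior h s) (sup_ball \<psi> f0 (d * 2 powr (- real J * \<beta>)))"
      by (rule ball)
    also have "\<dots> \<le> measure (prior h s) (sup_ball \<psi> f0 (d * (c / 2) powr (- \<beta>) * base_rate ?q \<beta> n))"
    proof (rule measure_sup_ball_mono)
      have "2 powr (- real J * \<beta>) = (2 powr real J) powr (- \<beta>)"
        by (simp add: powr_powr)
      also have "\<dots> \<le> (M n / 2) powr (- \<beta>)"
        using M_J elim(1) \<beta>_pos by (intro powr_mono2') auto
      also have "M n / 2 = (c / 2) * y n powr ?a"
        by (simp add: M_def)
      also have "\<dots> powr (- \<beta>) = (c / 2) powr (- \<beta>) * (y n powr ?a) powr (- \<beta>)"
        by (rule powr_mult)
      also have "(y n powr ?a) powr (- \<beta>) = (y n powr (-1)) powr (\<beta> / (1 + 2 * \<beta>))"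
        unfolding powr_powr by simp
      also have "y n powr (-1) = ln (real n) powr ?q / real n"
        using y by (simp add: y_def powr_minus_divide)
      finally have "2 powr (- real J * \<beta>) \<le> (c / 2) powr (- \<beta>) * base_rate ?q \<beta> n"
        by (simp add: base_rate_def)
      then show "d * 2 powr (- real J * \<beta>) \<le> d * (c / 2) powr (- \<beta>) * base_rate ?q \<beta> n"
        using d by (simp add: mult.assoc)
    qed
    finally show ?case .
  qed
  then show ?thesis
    using d c by (intro that[of "d * (c / 2) powr (- \<beta>)"]) auto
qed

text \<open>A larger rate lowers the exponential and enlarges the ball, so the same
  \<open>d1\<close> works.\<close>

lemma small_ball_of_rate_ge:
  assumes "0 < d2" and rate: "\<forall>\<^sub>F n in sequentially. base_rate (p * (1 + \<kappa>)) \<beta> n \<le> \<epsilon> n"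
  shows "\<exists>d1>0. \<forall>\<^sub>F n in sequentially.
    exp (- d2 * real n * (\<epsilon> n)\<^sup>2) \<le> measure (prior h s) (sup_ball \<psi> f0 (d1 * \<epsilon> n))"
proof -
  let ?r = "base_rate (p * (1 + \<kappa>)) \<beta>"
  obtain d1 where d1: "0 < d1" and ball: "\<forall>\<^sub>F n in sequentially.
      exp (- d2 * real n * (?r n)\<^sup>2) \<le> measure (prior h s) (sup_ball \<psi> f0 (d1 * ?r n))"
    using small_ball_base_rate[OF assms(1)] by blast
  from ball rate have "\<forall>\<^sub>F n in sequentially.
    exp (- d2 * real n * (\<epsilon> n)\<^sup>2) \<le> measure (prior h s) (sup_ball \<psi> f0 (d1 * \<epsilon> n))"
  proof eventually_elim
    case (elim n)
    have "0 \<le> ?r n"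
      by (simp add: base_rate_def)
    then have "d2 * real n * (?r n)\<^sup>2 \<le> d2 * real n * (\<epsilon> n)\<^sup>2"
      using elim(2) assms(1) by (intro mult_left_mono power_mono) auto
    then have "exp (- d2 * real n * (\<epsilon> n)\<^sup>2) \<le> exp (- d2 * real n * (?r n)\<^sup>2)"
      by simp
    also note elim(1)
    also have "measure (prior h s) (sup_ball \<psi> f0 (d1 * ?r n)) \<le> measure (prior h s) (sup_ball \<psi> f0 (d1 * \<epsilon> n))"
      using d1 elim(2) by (intro measure_sup_ball_mono mult_left_mono) auto
    finally show ?case .
  qed
  then show ?thesis
    using d1 by blast
qed

end

section \<open>Comparison with the stated rates and conclusion\<close>

lemma base_rate_eq:
  assumes "0 < ln (real n)"
  shows "base_rate q \<beta> n = ln (real n) powr (q * (\<beta> / (1 + 2 * \<beta>))) * real n powr (- \<beta> / (2 * \<beta> + 1))"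
proof -
  have "0 < real n"
    using assms by (cases "n = 0") auto
  then show ?thesis
    using assms by (simp add: base_rate_def powr_divide powr_powr powr_minus_divide add.commute)
qed

text \<open>The quotient of the rates is (ln ln n)^(2/(1 + 2 \<beta>)) (ln n)^(1/(1 + 2 \<beta>)),
  which is at least 1 once both logarithms are.\<close>

lemma base_rate_le_rate_regular:
  assumes "0 < \<beta>"
  shows "\<forall>\<^sub>F n in sequentially. base_rate (1 * (1 + \<kappa>)) \<beta> n \<le> rate_regular \<kappa> \<beta> n"
proof -
  have "\<forall>\<^sub>F n in sequentially. 1 \<le> ln (real n)" "\<forall>\<^sub>F n in sequentially. 1 \<le> ln (ln (real n))"
    by real_asymp+
  then show ?thesis
  proof eventually_elim
    case (elim n)
    have "1 * (ln (real n) powr ((1 + \<kappa>) * (\<beta> / (1 + 2 * \<beta>)))) \<le>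
        ln (ln (real n)) powr (2 / (1 + 2 * \<beta>)) * ln (real n) powr ((1 + (1 + \<kappa>) * \<beta>) / (1 + 2 * \<beta>))"
      using elim assms by (intro mult_mono ge_one_powr_ge_zero powr_mono) (auto simp: divide_right_mono)
    then show ?case
      using elim(1) by (simp add: base_rate_eq rate_regular_def mult_right_mono)
  qed
qed

text \<open>For \<open>p = 2\<close> the two rates coincide as soon as ln n is positive.\<close>

lemma base_rate_le_rate_supersmooth:
  "\<forall>\<^sub>F n in sequentially. base_rate (2 * (1 + \<kappa>)) \<beta> n \<le> rate_supersmooth \<kappa> \<beta> n"
proof -
  have "\<forall>\<^sub>F n in sequentially. 1 \<le> ln (real n)"
    by real_asymp
  then show ?thesis
    by eventually_elim (simp add: base_rate_eq rate_supersmooth_def distrib_left)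
qed

theorem theorem7:
  fixes \<psi> :: "nat \<Rightarrow> nat \<Rightarrow> real \<Rightarrow> real" and h :: "real \<Rightarrow> real" and \<kappa> c1 c2 :: real
  assumes basis: "localized_orthonormal_basis \<psi>"
    and h_measurable: "h \<in> borel_measurable borel"
    and h_density: "prob_space (density lborel (\<lambda>x. ennreal (h x)))"
    and h_symmetric: "\<And>x. h (- x) = h x"
    and h_positive: "\<And>x. 0 < h x"
    and h_bounded: "bounded (range h)"
    and h_decreasing: "antimono_on {0..} h"
    and const_ranges: "0 < c1" "0 \<le> \<kappa>" "0 < c2"
    and h_lower: "\<And>x. 0 \<le> x \<Longrightarrow> ln (1 / h x) \<le> c1 * (1 + ln (1 + x) powr (1 + \<kappa>))"
    and h_tail: "\<And>x. 1 \<le> x \<Longrightarrow> (LINT u:{x..}|lborel. h u) \<le> c2 / x\<^sup>2"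
  shows "(\<forall>\<alpha> > 1/2. \<forall>\<beta> L f0 d2. 0 < \<beta> \<longrightarrow> \<beta> \<le> \<alpha> \<longrightarrow> 0 < L \<longrightarrow> f0 \<in> holder_ball \<psi> \<beta> L \<longrightarrow> 0 < d2 \<longrightarrow>
            (\<exists>d1 > 0. \<forall>\<^sub>F n in sequentially.
               measure (prior h (\<lambda>l. 2 powr (- real l * (1/2 + \<alpha>))))
                       (sup_ball \<psi> f0 (d1 * rate_regular \<kappa> \<beta> n))
               \<ge> exp (- d2 * real n * (rate_regular \<kappa> \<beta> n)\<^sup>2)))
       \<and> (\<forall>\<beta> L f0 d2. 0 < \<beta> \<longrightarrow> 0 < L \<longrightarrow> f0 \<in> holder_ball \<psi> \<beta> L \<longrightarrow> 0 < d2 \<longrightarrow>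
            (\<exists>d1 > 0. \<forall>\<^sub>F n in sequentially.
               measure (prior h (\<lambda>l. 2 powr (- ((real l)\<^sup>2))))
                       (sup_ball \<psi> f0 (d1 * rate_supersmooth \<kappa> \<beta> n))
               \<ge> exp (- d2 * real n * (rate_supersmooth \<kappa> \<beta> n)\<^sup>2)))"
proof -
  have noise: "noise_density h \<kappa> c1 c2"
    using assms(2-5,7-12) by (rule noise_density.intro)
  obtain C0 where C0: "\<And>l x. x \<in> {0..1} \<Longrightarrow> (\<Sum>k\<in>wav_idx l. \<bar>\<psi> l k x\<bar>) \<le> C0 * 2 powr (real l / 2)"
    using basis unfolding localized_orthonormal_basis_def by blast
  define C where "C = max C0 1"
  have "C0 * 2 powr (real l / 2) \<le> C * 2 powr (real l / 2)" for l
    by (intro mult_right_mono) (auto simp: C_def)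
  from order.trans[OF C0 this] have family: "localized_family \<psi> C"
    by unfold_locales (auto simp: C_def)
  have target: "wavelet_target \<psi> C f0 (wav_coeff \<psi> f0) \<beta> L"
    if "0 < \<beta>" "0 < L" "f0 \<in> holder_ball \<psi> \<beta> L" for f0 \<beta> L
  proof -
    have "\<bar>wav_coeff \<psi> f0 l k\<bar> \<le> L * 2 powr (- real l * (1/2 + \<beta>))" if "k \<in> wav_idx l" for l k
    proof -
      have "\<bar>wav_coeff \<psi> f0 l k\<bar> \<le> (MAX k\<in>wav_idx l. \<bar>wav_coeff \<psi> f0 l k\<bar>)"
        using that by (intro Max_ge) auto
      then show ?thesis
        using \<open>f0 \<in> _\<close> by (auto simp: holder_ball_def mult.commute intro: order.trans)
    qed
    then show ?thesis
      using that by (intro wavelet_target.intro family wavelet_target_axioms.intro) (auto simp: holder_ball_def)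
  qed
  have ln_2: "ln 2 \<le> (1::real)"
    using ln_2_less_1 by simp
  show ?thesis
  proof (intro conjI allI impI)
    fix \<alpha> \<beta> L d2 :: real and f0
    assume \<alpha>: "1/2 < \<alpha>" and \<beta>: "0 < \<beta>" "\<beta> \<le> \<alpha>" and f0: "0 < L" "f0 \<in> holder_ball \<psi> \<beta> L" and d2: "0 < d2"
    define s where "s l = 2 powr (- real l * (1/2 + \<alpha>))" for l
    have "s l \<le> 2 powr 0" for l
      unfolding s_def using \<alpha> by (intro powr_mono mult_nonpos_nonneg) auto
    moreover have "- ln (s l) \<le> (1/2 + \<alpha>) * (1 + real l) powr 1" for l
    proof -
      have "- ln (s l) = (1/2 + \<alpha>) * real l * ln 2"
        by (simp add: s_def ln_powr)
      also have "\<dots> \<le> (1/2 + \<alpha>) * real l * 1"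
        using ln_2 \<alpha> by (intro mult_left_mono) auto
      also have "\<dots> \<le> (1/2 + \<alpha>) * (1 + real l) powr 1"
        using \<alpha> by simp
      finally show ?thesis .
    qed
    \<comment> \<open>With \<eta> = (\<alpha> - 1/2) / 2 one has 1 + 2 \<eta> = 1/2 + \<alpha>, so
      \<open>s_upper\<close> is an equality with constant 1, and 1/2 + 2 \<eta> = \<alpha>, so
      \<open>\<beta>_le\<close> is the hypothesis \<beta> \<le> \<alpha>.\<close>
    ultimately have "prior_setup h \<kappa> c1 c2 \<psi> C f0 (wav_coeff \<psi> f0) \<beta> L s 1 ((\<alpha> - 1/2) / 2) 1 (1/2 + \<alpha>)"
      using \<alpha> \<beta> by (intro prior_setup.intro noise target f0 prior_setup_axioms.intro)
        (auto simp: s_def field_simps)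
    from prior_setup.small_ball_of_rate_ge[OF this d2 base_rate_le_rate_regular[OF \<beta>(1)]]
    show "\<exists>d1 > 0. \<forall>\<^sub>F n in sequentially.
        measure (prior h (\<lambda>l. 2 powr (- real l * (1/2 + \<alpha>)))) (sup_ball \<psi> f0 (d1 * rate_regular \<kappa> \<beta> n))
        \<ge> exp (- d2 * real n * (rate_regular \<kappa> \<beta> n)\<^sup>2)"
      unfolding s_def .
  next
    fix \<beta> L d2 :: real and f0
    assume \<beta>: "0 < \<beta>" and f0: "0 < L" "f0 \<in> holder_ball \<psi> \<beta> L" and d2: "0 < d2"
    define s where "s l = 2 powr (- ((real l)\<^sup>2))" for l
    \<comment> \<open>An auxiliary regularity: it must be at least \<beta>, and above 1/2 so that
      \<eta> is positive. The supersmooth scales lie below a multiple of the regular ones for this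
      \<alpha>.\<close>
    define \<alpha> where "\<alpha> = max \<beta> 1"
    have \<alpha>: "\<beta> \<le> \<alpha>" "1 \<le> \<alpha>"
      by (auto simp: \<alpha>_def)
    have "s l \<le> 2 powr 0" for l
      unfolding s_def by (intro powr_mono) auto
    moreover have "s l \<le> 2 powr ((1/2 + \<alpha>)\<^sup>2) * 2 powr (- real l * (1 + 2 * ((\<alpha> - 1/2) / 2)))" for l
    proof -
      \<comment> \<open>Completing the square in a^2 - a l + l^2 with a = 1/2 + \<alpha> yields the
        constant 2^(a^2).\<close>
      have "0 \<le> (1/2 + \<alpha> - real l / 2)\<^sup>2 + 3 / 4 * (real l)\<^sup>2"
        by simp
      also have "\<dots> = (1/2 + \<alpha>)\<^sup>2 + - real l * (1 + 2 * ((\<alpha> - 1/2) / 2)) + (real l)\<^sup>2"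
        by (simp add: power2_eq_square field_simps)
      finally show ?thesis
        unfolding s_def powr_add[symmetric] by (intro powr_mono) auto
    qed
    moreover have "\<beta> \<le> 1/2 + 2 * ((\<alpha> - 1/2) / 2)"
      using \<alpha> by (simp add: field_simps)
    moreover have "- ln (s l) \<le> 1 * (1 + real l) powr 2" for l
    proof -
      have "- ln (s l) = (real l)\<^sup>2 * ln 2"
        by (simp add: s_def ln_powr)
      also have "\<dots> \<le> (1 + real l)\<^sup>2 * 1"
        using ln_2 by (intro mult_mono power_mono) auto
      finally show ?thesis
        by simp
    qed
    ultimately have "prior_setup h \<kappa> c1 c2 \<psi> C f0 (wav_coeff \<psi> f0) \<beta> L s
        (2 powr ((1/2 + \<alpha>)\<^sup>2)) ((\<alpha> - 1/2) / 2) 2 1"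
      using \<beta> \<alpha> by (intro prior_setup.intro noise target f0 prior_setup_axioms.intro)
        (auto simp: s_def)
    from prior_setup.small_ball_of_rate_ge[OF this d2 base_rate_le_rate_supersmooth]
    show "\<exists>d1 > 0. \<forall>\<^sub>F n in sequentially.
        measure (prior h (\<lambda>l. 2 powr (- ((real l)\<^sup>2)))) (sup_ball \<psi> f0 (d1 * rate_supersmooth \<kappa> \<beta> n))
        \<ge> exp (- d2 * real n * (rate_supersmooth \<kappa> \<beta> n)\<^sup>2)"
      unfolding s_def .
  qed
qed

end
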